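(* Let $\kappa$ be a regular uncountable cardinal and assume the proxy principle $\mathrm{P}(\kappa,2,{\sqsubseteq},\kappa)$. If there exists a $\kappa$-Kurepa tree, then there exists a $\kappa$-Aronszajn tree $\mathbf T$ admitting $\kappa^+$-many subtrees, each of which is a $\kappa$-Souslin tree, such that the product of any finitely many (at least one) distinct ones among them is again a $\kappa$-Souslin tree.
   Context: A $\kappa$-tree is a tree of height $\kappa$ all of whose levels are nonempty and of size $<\kappa$; a $\kappa$-Aronszajn tree is a $\kappa$-tree with no branch of length $\kappa$; a $\kappa$-Souslin tree is a $\kappa$-Aronszajn tree with no antichain of size $\kappa$; a $\kappa$-Kurepa tree is a $\kappa$-tree with more than $\kappa$ cofinal branches. A subtree of a tree means a downward-closed subset. The product $\bigotimes_{j<\tau}T^j$ of trees $T^j$ is the set of sequences $\langle x_j\mid j<\tau\rangle$ with $x_j\in T^j$, all $x_j$ of the same height, ordered coordinatewise (strictly below in every coordinate). Notation: for a set $C$ of ordinals, $\mathrm{acc}(C)=\{\beta\in C\mid \sup(C\cap\beta)=\beta>0\}$ and $\mathrm{nacc}(C)=C\setminus\mathrm{acc}(C)$; for $n<\omega$ and a set $D$ of ordinals, $\mathrm{suc}_n(D)=\{\delta\in\mathrm{nacc}(D)\mid 0<\mathrm{otp}(D\cap\delta)\le n\}$. $\mathrm{P}(\kappa,2,{\sqsubseteq},\kappa)$ is the conjunction of $\diamondsuit(\kappa)$ with the assertion that there is a sequence $\langle C_\alpha\mid\alpha<\kappa\rangle$ such that: (1) each $C_\alpha$ is a closed subset of $\alpha$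 with $\sup(C_\alpha)=\sup(\alpha)$ (where $\sup(\alpha)=\bigcup\alpha$); (2) for all $\alpha<\kappa$ and $\bar\alpha\in\mathrm{acc}(C_\alpha)$, $C_{\bar\alpha}=C_\alpha\cap\bar\alpha$; (3) for every sequence $\langle B_i\mid i<\kappa\rangle$ of cofinal subsets of $\kappa$ there are stationarily many $\alpha<\kappa$ such that for all $i<\alpha$ and all $n<\omega$, $\sup\{\beta\in C_\alpha\mid \mathrm{suc}_n(C_\alpha\setminus\beta)\subseteq B_i\}=\alpha$. *)

theory Defs
  imports Main
begin

text \<open>The ordinals below kappa are represented by the elements of a well-ordered
type 'a whose order type is kappa.  kappa_rel is the (non-strict) well-order of
'a, viewed as a cardinal in the sense of the BNF cardinal library (Main).\<close>

definition kappa_rel :: "('a::wellorder) rel" where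
  "kappa_rel = {(x, y). x \<le> y}"

definition ozero :: "'a::wellorder" where
  "ozero = (LEAST x. True)"

definition osup :: "('a::wellorder) set \<Rightarrow> 'a" where
  "osup X = (LEAST y. \<forall>x\<in>X. x \<le> y)"

abbreviation oset :: "'a::wellorder \<Rightarrow> 'a set" where
  "oset \<alpha> \<equiv> {\<beta>. \<beta> < \<alpha>}"

definition acc :: "('a::wellorder) set \<Rightarrow> 'a set" where
  "acc C = {\<beta> \<in> C. osup (C \<inter> oset \<beta>) = \<beta> \<and> ozero < \<beta>}"

definition nacc :: "('a::wellorder) set \<Rightarrow> 'a set" where
  "nacc C = C - acc C"

text \<open>suc_n(D) = {delta in nacc(D) | 0 < otp(D cap delta) <= n}; for a finite
bound n the order type of D cap delta is its (finite) cardinality.\<close>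
definition suc_n :: "nat \<Rightarrow> ('a::wellorder) set \<Rightarrow> 'a set" where
  "suc_n n D = {\<delta> \<in> nacc D. D \<inter> oset \<delta> \<noteq> {} \<and> finite (D \<inter> oset \<delta>)
                              \<and> card (D \<inter> oset \<delta>) \<le> n}"

definition closed_subset_of :: "('a::wellorder) set \<Rightarrow> 'a \<Rightarrow> bool" where
  "closed_subset_of C \<alpha> \<longleftrightarrow> C \<subseteq> oset \<alpha> \<and>
     (\<forall>\<gamma>. \<gamma> < \<alpha> \<and> osup (C \<inter> oset \<gamma>) = \<gamma> \<and> ozero < \<gamma> \<longrightarrow> \<gamma> \<in> C)"

definition unbounded :: "('a::wellorder) set \<Rightarrow> bool" where
  "unbounded D \<longleftrightarrow> (\<forall>x. \<exists>y\<in>D. x \<le> y)"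

definition club :: "('a::wellorder) set \<Rightarrow> bool" where
  "club D \<longleftrightarrow> unbounded D \<and>
     (\<forall>\<gamma>. osup (D \<inter> oset \<gamma>) = \<gamma> \<and> ozero < \<gamma> \<longrightarrow> \<gamma> \<in> D)"

definition stationary :: "('a::wellorder) set \<Rightarrow> bool" where
  "stationary S \<longleftrightarrow> (\<forall>D. club D \<longrightarrow> S \<inter> D \<noteq> {})"

definition diamond :: "('a::wellorder) itself \<Rightarrow> bool" where
  "diamond _ \<longleftrightarrow> (\<exists>A :: 'a \<Rightarrow> 'a set. (\<forall>\<alpha>. A \<alpha> \<subseteq> oset \<alpha>) \<and>
      (\<forall>X :: 'a set. stationary {\<alpha>. X \<inter> oset \<alpha> = A \<alpha>}))"

definition proxy_P :: "('a::wellorder) itself \<Rightarrow> bool" where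
  "proxy_P t \<longleftrightarrow> diamond t \<and>
    (\<exists>C :: 'a \<Rightarrow> 'a set.
       (\<forall>\<alpha>. closed_subset_of (C \<alpha>) \<alpha> \<and> osup (C \<alpha>) = osup (oset \<alpha>)) \<and>
       (\<forall>\<alpha>. \<forall>\<alpha>' \<in> acc (C \<alpha>). C \<alpha>' = C \<alpha> \<inter> oset \<alpha>') \<and>
       (\<forall>B :: 'a \<Rightarrow> 'a set. (\<forall>i. unbounded (B i)) \<longrightarrow>
          stationary {\<alpha>. \<forall>i < \<alpha>. \<forall>n::nat.
             osup {\<beta> \<in> C \<alpha>. suc_n n (C \<alpha> - oset \<beta>) \<subseteq> B i} = \<alpha>}))"

definition is_tree :: "'n set \<Rightarrow> ('n \<Rightarrow> 'n \<Rightarrow> bool) \<Rightarrow> bool" where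
  "is_tree T lt \<longleftrightarrow>
     (\<forall>x\<in>T. \<not> lt x x) \<and>
     (\<forall>x\<in>T. \<forall>y\<in>T. \<forall>z\<in>T. lt x y \<and> lt y z \<longrightarrow> lt x z) \<and>
     (\<forall>x\<in>T. \<forall>y\<in>T. \<forall>z\<in>T. lt y x \<and> lt z x \<longrightarrow> lt y z \<or> y = z \<or> lt z y) \<and>
     (\<forall>x\<in>T. \<forall>S. S \<subseteq> {y\<in>T. lt y x} \<and> S \<noteq> {} \<longrightarrow> (\<exists>m\<in>S. \<forall>s\<in>S. \<not> lt s m))"

definition preds :: "'n set \<Rightarrow> ('n \<Rightarrow> 'n \<Rightarrow> bool) \<Rightarrow> 'n \<Rightarrow> 'n set" where
  "preds T lt x = {y \<in> T. lt y x}"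

definition has_height :: "'n set \<Rightarrow> ('n \<Rightarrow> 'n \<Rightarrow> bool) \<Rightarrow> 'n \<Rightarrow> 'a::wellorder \<Rightarrow> bool" where
  "has_height T lt x \<alpha> \<longleftrightarrow> (\<exists>f. bij_betw f (preds T lt x) (oset \<alpha>) \<and>
      (\<forall>y\<in>preds T lt x. \<forall>z\<in>preds T lt x. lt y z \<longleftrightarrow> f y < f z))"

definition level :: "'n set \<Rightarrow> ('n \<Rightarrow> 'n \<Rightarrow> bool) \<Rightarrow> 'a::wellorder \<Rightarrow> 'n set" where
  "level T lt \<alpha> = {x \<in> T. has_height T lt x \<alpha>}"

definition kappa_tree :: "'a::wellorder itself \<Rightarrow> 'n set \<Rightarrow> ('n \<Rightarrow> 'n \<Rightarrow> bool) \<Rightarrow> bool" where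
  "kappa_tree _ T lt \<longleftrightarrow> is_tree T lt \<and>
     (\<forall>x\<in>T. \<exists>\<alpha>::'a. has_height T lt x \<alpha>) \<and>
     (\<forall>\<alpha>::'a. level T lt \<alpha> \<noteq> {} \<and> ordLess2 (card_of (level T lt \<alpha>)) (kappa_rel :: 'a rel))"

definition cofinal_branch :: "'a::wellorder itself \<Rightarrow> 'n set \<Rightarrow> ('n \<Rightarrow> 'n \<Rightarrow> bool) \<Rightarrow> 'n set \<Rightarrow> bool" where
  "cofinal_branch _ T lt b \<longleftrightarrow> b \<subseteq> T \<and>
     (\<forall>x\<in>b. \<forall>y\<in>b. lt x y \<or> x = y \<or> lt y x) \<and>
     (\<forall>x\<in>b. \<forall>y\<in>T. lt y x \<longrightarrow> y \<in> b) \<and>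
     (\<forall>\<alpha>::'a. b \<inter> level T lt \<alpha> \<noteq> {})"

definition antichain :: "'n set \<Rightarrow> ('n \<Rightarrow> 'n \<Rightarrow> bool) \<Rightarrow> 'n set \<Rightarrow> bool" where
  "antichain T lt A \<longleftrightarrow> A \<subseteq> T \<and> (\<forall>x\<in>A. \<forall>y\<in>A. x \<noteq> y \<longrightarrow> \<not> lt x y)"

definition aronszajn :: "'a::wellorder itself \<Rightarrow> 'n set \<Rightarrow> ('n \<Rightarrow> 'n \<Rightarrow> bool) \<Rightarrow> bool" where
  "aronszajn t T lt \<longleftrightarrow> kappa_tree t T lt \<and> (\<nexists>b. cofinal_branch t T lt b)"

definition souslin :: "'a::wellorder itself \<Rightarrow> 'n set \<Rightarrow> ('n \<Rightarrow> 'n \<Rightarrow> bool) \<Rightarrow> bool" where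
  "souslin t T lt \<longleftrightarrow> aronszajn t T lt \<and>
     (\<forall>A. antichain T lt A \<longrightarrow> ordLess2 (card_of A) (kappa_rel :: 'a rel))"

definition kurepa :: "'a::wellorder itself \<Rightarrow> 'n set \<Rightarrow> ('n \<Rightarrow> 'n \<Rightarrow> bool) \<Rightarrow> bool" where
  "kurepa t T lt \<longleftrightarrow> kappa_tree t T lt \<and>
     ordLess2 (kappa_rel :: 'a rel) (card_of {b. cofinal_branch t T lt b})"

definition subtree :: "'n set \<Rightarrow> ('n \<Rightarrow> 'n \<Rightarrow> bool) \<Rightarrow> 'n set \<Rightarrow> bool" where
  "subtree T lt S \<longleftrightarrow> S \<subseteq> T \<and> (\<forall>x\<in>S. \<forall>y\<in>T. lt y x \<longrightarrow> y \<in> S)"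

definition prod_nodes :: "'a::wellorder itself \<Rightarrow> 'n set list \<Rightarrow> ('n \<Rightarrow> 'n \<Rightarrow> bool) \<Rightarrow> 'n list set" where
  "prod_nodes _ Ts lt = {xs. length xs = length Ts \<and> (\<forall>j < length Ts. xs ! j \<in> Ts ! j) \<and>
      (\<exists>\<alpha>::'a. \<forall>j < length Ts. has_height (Ts ! j) lt (xs ! j) \<alpha>)}"

definition prod_lt :: "('n \<Rightarrow> 'n \<Rightarrow> bool) \<Rightarrow> 'n list \<Rightarrow> 'n list \<Rightarrow> bool" where
  "prod_lt lt xs ys \<longleftrightarrow> length xs = length ys \<and> (\<forall>j < length xs. lt (xs ! j) (ys ! j))"

end

(*
Only branches of the Kurepa tree matter: they yield a family F of more than kappa subsets of kappa
with fewer than kappa traces on each alpha, which may be taken closed under limits of traces.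

By recursion on alpha one builds, for every trace E of F on alpha, a level lev alpha E of a tree of
subsets of alpha ordered by end-extension. A limit level consists of canonical branches climbing
along C alpha, and coherence of the ladders keeps these branches inside the tree at accumulation
points. At a non-accumulation point beta the diamond sequence guesses finitely many members of F,
a tuple of starting nodes and a dense open set D of the product; a branch whose trace is one of the
guessed ones and which began at the corresponding starting node moves into D, together with the
branches of the other guessed traces. The proxy principle makes these guesses correct often enough
that some level of the product of trees over distinct members of F lies entirely inside a given D,
so antichains of the product are bounded.

Nodes carry their trace, so all trees fit into a single tree, and a cofinal branch of it would
determine a member of F and hence a cofinal branch of one of the Souslin trees.
*)

theory Submission
  imports Defs
begin

section \<open>Regular cardinals and closed points\<close>

text \<open>There are more than kappa trees to build, but the common tree may only have small
  levels. This is why level \<alpha> of a tree depends on the member of the family only through its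
  trace on \<alpha>: fewer than kappa trees are visible at any stage, and two of them can differ
  only once their traces differ.

  The obstacle is that each tree is climbed separately, while a dense open set of the product has to
  be entered by a whole tuple of branches. Agreement comes without communication: a branch that
  moves at \<beta> recomputes the positions of all guessed branches at the previous ladder point and
  applies a choice that does not mention its own coordinate, so every coordinate arrives at the same
  tuple. The guess must name the starting nodes because many branches of one tree climb along the
  same ladder.

  A single level has to absorb all tuples of branches at once. Hence the proxy principle is applied
  to kappa many sets, one for each code of a tuple of starting nodes.\<close>

locale regular_cardinal =
  fixes \<kappa> :: "'a::wellorder rel"
  assumes kappa_eq: "\<kappa> = kappa_rel"
    and card: "card_order \<kappa>"
    and regular: "regularCard \<kappa>"
    and uncountable: "ordLess2 natLeq \<kappa>"
begin

abbreviation small :: "'b set \<Rightarrow> bool" where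
  "small X \<equiv> ordLess2 (card_of X) \<kappa>"

lemma Field_kappa: "Field \<kappa> = UNIV"
  by (auto simp: kappa_eq kappa_rel_def Field_def)

lemma Card_order_kappa: "Card_order \<kappa>"
  using card Field_kappa by simp

lemma Cinfinite_kappa: "Cinfinite \<kappa>"
proof -
  have "ordLeq3 natLeq \<kappa>"
    using uncountable ordLess_imp_ordLeq by blast
  then show ?thesis
    using Card_order_kappa cinfinite_mono natLeq_Cinfinite cinfinite_def by blast
qed

lemma infinite_UNIV_kappa: "infinite (UNIV :: 'a set)"
  using Cinfinite_kappa Field_kappa by (simp add: cinfinite_def)

lemma small_subset: "small Y \<Longrightarrow> X \<subseteq> Y \<Longrightarrow> small X"
  using card_of_mono1 ordLeq_ordLess_trans by blast

lemma small_image: "small X \<Longrightarrow> small (f ` X)"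
  using card_of_image ordLeq_ordLess_trans by blast

lemma small_finite: "finite X \<Longrightarrow> small X"
  using finite_ordLess_infinite[OF card_of_Well_order, of \<kappa> X] Cinfinite_kappa
  by (simp add: Field_card_of cinfinite_def card_order_on_def)

text \<open>Regularity of kappa enters the counting here; smallness of finite unions, products and
  sets of lists reduces to it.\<close>

lemma small_UN: "small I \<Longrightarrow> (\<And>i. i \<in> I \<Longrightarrow> small (A i)) \<Longrightarrow> small (\<Union>i\<in>I. A i)"
  using card_of_UNION_ordLess_infinite_Field_regularCard[OF regular Cinfinite_kappa] by blast

lemma small_Un: "small X \<Longrightarrow> small Y \<Longrightarrow> small (X \<union> Y)"
  using small_UN[of "{X, Y}" id] by (auto intro: small_finite)

lemma small_insert: "small X \<Longrightarrow> small (insert x X)"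
  using small_Un[of "{x}" X] by (simp add: small_finite)

lemma small_Times: "small X \<Longrightarrow> small Y \<Longrightarrow> small (X \<times> Y)"
proof -
  assume "small X" "small Y"
  then have "small (\<Union>x\<in>X. Pair x ` Y)" by (intro small_UN small_image)
  moreover have "(\<Union>x\<in>X. Pair x ` Y) = X \<times> Y" by auto
  ultimately show ?thesis by simp
qed

lemma small_lists_length: "small X \<Longrightarrow> small {xs. length xs = n \<and> set xs \<subseteq> X}"
proof (induction n)
  case 0
  show ?case by (rule small_finite) simp
next
  case (Suc n)
  let ?Y = "{xs. length xs = n \<and> set xs \<subseteq> X}"
  have "{xs. length xs = Suc n \<and> set xs \<subseteq> X} \<subseteq> (\<lambda>(x, xs). x # xs) ` (X \<times> ?Y)"
    by (auto simp: length_Suc_conv image_iff)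
  moreover have "small ((\<lambda>(x, xs). x # xs) ` (X \<times> ?Y))"
    using Suc by (intro small_image small_Times)
  ultimately show ?case by (rule small_subset[rotated])
qed

text \<open>Uncountability of kappa in the form used later: omega-sequences of ordinals are bounded,
  and the lists over a small set form a small set.\<close>

lemma small_range_nat: "small (range (h :: nat \<Rightarrow> 'b))"
  by (rule ordLeq_ordLess_trans[OF card_of_image ordIso_ordLess_trans[OF card_of_nat uncountable]])

lemma small_lists: "small X \<Longrightarrow> small (lists X)"
proof -
  assume X: "small X"
  have "small (UNIV :: nat set)" using small_range_nat[of id] by simp
  then have "small (\<Union>n. {xs. length xs = n \<and> set xs \<subseteq> X})"
    by (intro small_UN small_lists_length X)
  then show ?thesis by (rule small_subset) auto
qed

lemma small_oset: "small (oset (\<alpha>::'a))"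
proof -
  have "oset \<alpha> = underS \<kappa> \<alpha>" by (auto simp: underS_def kappa_eq kappa_rel_def)
  then show ?thesis using card_of_underS[OF Card_order_kappa, of \<alpha>] Field_kappa by simp
qed

lemma small_atMost: "small {..\<alpha>::'a}"
proof -
  have "{..\<alpha>} = insert \<alpha> (oset \<alpha>)" by auto
  then show ?thesis using small_insert small_oset by metis
qed

lemma not_small_UNIV: "\<not> small (UNIV :: 'a set)"
  using card_of_Field_ordIso[OF Card_order_kappa] not_ordLess_ordIso unfolding Field_kappa by blast

lemma ex_greater: "\<exists>\<beta>. (\<alpha>::'a) < \<beta>"
proof (rule ccontr)
  assume "\<nexists>\<beta>. \<alpha> < \<beta>"
  then have "UNIV = {..\<alpha>}" by (auto simp: not_less)
  then show False using not_small_UNIV small_atMost by metis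
qed

text \<open>An unbounded \<open>X\<close> would be cofinal, and regularity would then force it to
  have size kappa.\<close>

lemma small_bounded:
  assumes "small (X :: 'a set)"
  shows "\<exists>\<eta>. \<forall>x\<in>X. x < \<eta>"
proof (rule ccontr)
  assume *: "\<nexists>\<eta>. \<forall>x\<in>X. x < \<eta>"
  have "\<exists>x\<in>X. \<alpha> \<noteq> x \<and> (\<alpha>, x) \<in> \<kappa>" for \<alpha>
  proof -
    obtain \<beta> where "\<alpha> < \<beta>" using ex_greater by blast
    moreover obtain x where "x \<in> X" "\<not> x < \<beta>" using * by blast
    ultimately show ?thesis by (intro bexI[of _ x]) (auto simp: kappa_eq kappa_rel_def)
  qed
  then have "cofinal X \<kappa>"
    unfolding cofinal_def by blast
  then have "ordIso2 (card_of X) \<kappa>"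
    using regular unfolding regularCard_def Field_kappa by blast
  then show False using assms not_ordLess_ordIso by blast
qed

text \<open>A union of kappa many small sets has size at most kappa. Stratifying objects by an
  ordinal bound thus gives codes by single ordinals, for tokens, for tuples of starting nodes and
  for the nodes of trees.\<close>

lemma ex_inj_into_kappa:
  assumes "\<And>\<eta>::'a. small (Q \<eta>)"
  shows "\<exists>q :: 'b \<Rightarrow> 'a. inj_on q (\<Union>\<eta>. Q \<eta>)"
proof -
  have "ordLeq3 (card_of (Q \<eta>)) (card_of (UNIV :: 'a set))" for \<eta> :: 'a
    using ordLess_imp_ordLeq[OF ordLess_ordIso_trans[OF assms
          ordIso_symmetric[OF card_of_Field_ordIso[OF Card_order_kappa]]]]
    unfolding Field_kappa .
  then have "ordLeq3 (card_of (\<Union>\<eta>. Q \<eta>)) (card_of (UNIV :: 'a set))"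
    by (intro card_of_UNION_ordLeq_infinite infinite_UNIV_kappa card_of_refl ordIso_imp_ordLeq) auto
  then show ?thesis unfolding card_of_ordLeq[symmetric] by blast
qed

lemma osup_upper: "X \<subseteq> {..\<alpha>} \<Longrightarrow> x \<in> X \<Longrightarrow> x \<le> osup X"
  for \<alpha> :: 'a
  unfolding osup_def by (rule LeastI2[of _ \<alpha>]) auto

lemma osup_least: "(\<And>x. x \<in> X \<Longrightarrow> x \<le> \<alpha>) \<Longrightarrow> osup X \<le> \<alpha>"
  for \<alpha> :: 'a
  unfolding osup_def by (rule Least_le) auto

lemma ozero_le [simp]: "ozero \<le> (\<alpha>::'a)"
  unfolding ozero_def by (rule Least_le) simp

lemma less_osup: "X \<subseteq> oset \<alpha> \<Longrightarrow> \<xi> < osup X \<Longrightarrow> \<exists>x\<in>X. \<xi> < x"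
  for \<alpha> :: 'a
  by (meson leD leI osup_least)

lemma osup_le_bound: "X \<subseteq> oset \<alpha> \<Longrightarrow> osup X \<le> \<alpha>" for \<alpha> :: 'a
  by (intro osup_least) auto

lemma osup_ge: "X \<subseteq> oset \<alpha> \<Longrightarrow> x \<in> X \<Longrightarrow> x \<le> osup X" for \<alpha> :: 'a
  by (rule osup_upper[of X \<alpha>]) auto

definition bound :: "'a set \<Rightarrow> 'a" where
  "bound X = (SOME \<eta>. \<forall>x\<in>X. x < \<eta>)"

lemma bound: "small X \<Longrightarrow> x \<in> X \<Longrightarrow> x < bound X"
  unfolding bound_def using someI_ex[OF small_bounded] by blast

lemma club_closed_points: "club {\<beta>::'a. \<xi> < \<beta> \<and> (\<forall>\<eta><\<beta>. g \<eta> < \<beta>)}"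
  (is "club ?D")
proof -
  have "\<exists>y\<in>?D. x \<le> y" for x
  proof -
    \<comment> \<open>Putting \<open>y\<close> itself into the bounded set makes \<open>h\<close>
      strictly increasing, so every value lies strictly below the supremum \<beta>; bounding the
      image of \<open>{..y}\<close> makes \<beta> closed under \<open>g\<close>.\<close>
    define h where "h = rec_nat (max x \<xi>) (\<lambda>_ y. bound (insert y (g ` {..y})))"
    have small_step: "small (insert y (g ` {..y}))" for y :: 'a
      by (intro small_insert small_image small_atMost)
    have h0: "h 0 = max x \<xi>" and hS: "h (Suc k) = bound (insert (h k) (g ` {..h k}))" for k
      unfolding h_def by auto
    have inc: "h k < h (Suc k)" for k
      unfolding hS by (rule bound[OF small_step]) simp
    have step: "g \<eta> < h (Suc k)" if "\<eta> \<le> h k" for \<eta> k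
      unfolding hS by (rule bound[OF small_step]) (use that in auto)
    obtain b where b: "range h \<subseteq> oset b"
      using small_bounded[OF small_range_nat[of h]] by blast
    define \<beta> where "\<beta> = osup (range h)"
    have lt: "h k < \<beta>" for k
      using osup_ge[OF b, of "h (Suc k)"] inc[of k] unfolding \<beta>_def by auto
    have "g \<eta> < \<beta>" if less: "\<eta> < \<beta>" for \<eta>
    proof -
      obtain k where "\<eta> < h k" using less_osup[OF b, of \<eta>] less unfolding \<beta>_def by auto
      then have "g \<eta> < h (Suc k)" by (intro step) simp
      then show ?thesis using lt[of "Suc k"] by (rule less_trans)
    qed
    then have "\<beta> \<in> ?D" using lt[of 0] unfolding h0 by auto
    then show ?thesis using lt[of 0] unfolding h0 by (intro bexI[of _ \<beta>]) auto
  qed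
  moreover have "\<gamma> \<in> ?D" if sup: "osup (?D \<inter> oset \<gamma>) = \<gamma>" and pos: "ozero < \<gamma>" for \<gamma>
  proof -
    have sub: "?D \<inter> oset \<gamma> \<subseteq> oset \<gamma>" by auto
    have "\<exists>\<beta>\<in>?D. \<eta> < \<beta> \<and> \<beta> < \<gamma>" if "\<eta> < \<gamma>" for \<eta>
      using less_osup[OF sub, of \<eta>] that unfolding sup by blast
    then show ?thesis using pos by (force intro: less_trans)
  qed
  ultimately show ?thesis unfolding club_def unbounded_def by blast
qed

lemma stationary_closed_point:
  assumes "stationary (S :: 'a set)"
  obtains \<beta> where "\<beta> \<in> S" "\<xi> < \<beta>" "\<And>\<eta>. \<eta> < \<beta> \<Longrightarrow> g \<eta> < \<beta>"
  using assms club_closed_points[of \<xi> g] unfolding stationary_def by blast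

end

section \<open>Guessing finite data\<close>

text \<open>The diamond sequence guesses one subset of \<open>'a\<close>; tokens pack into it the starting nodes
(whose number is the number of guessed traces), the traces and the dense set.\<close>

datatype 'a token = Start "('a \<times> 'a) list" | Branch nat 'a | Dense 'a "'a list"

context regular_cardinal
begin

lemma ex_list_bound: "\<exists>\<eta>::'a. set xs \<subseteq> {..\<eta>}"
proof -
  obtain \<eta> where "\<forall>x\<in>set xs. x < \<eta>"
    using small_bounded[of "set xs"] small_finite by blast
  then show ?thesis by (intro exI[of _ \<eta>]) auto
qed

lemma ex_inj_token: "\<exists>q :: 'a token \<Rightarrow> 'a. inj q"
proof -
  define Q :: "'a \<Rightarrow> 'a token set" where
    "Q \<eta> = Start ` lists ({..\<eta>} \<times> {..\<eta>}) \<union> (\<lambda>(j, \<xi>). Branch j \<xi>) ` (UNIV \<times> {..\<eta>})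
            \<union> (\<lambda>(\<delta>, is). Dense \<delta> is) ` ({..\<eta>} \<times> lists {..\<eta>})" for \<eta>
  have "small (UNIV :: nat set)" using small_range_nat[of id] by simp
  then have "small (Q \<eta>)" for \<eta>
    unfolding Q_def by (intro small_Un small_image small_Times small_lists small_atMost)
  then obtain q :: "'a token \<Rightarrow> 'a" where q: "inj_on q (\<Union>\<eta>. Q \<eta>)"
    using ex_inj_into_kappa by blast
  have "T \<in> (\<Union>\<eta>. Q \<eta>)" for T
  proof (cases T)
    case (Start ps)
    obtain \<eta> where \<eta>: "set (map fst ps @ map snd ps) \<subseteq> {..\<eta>}" using ex_list_bound by blast
    have "x \<in> {..\<eta>} \<times> {..\<eta>}" if "x \<in> set ps" for x
      using \<eta> that by (cases x) (force simp: image_subset_iff)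
    then have "T \<in> Q \<eta>" unfolding Q_def Start by auto
    then show ?thesis by blast
  next
    case (Branch j \<xi>)
    then have "T \<in> Q \<xi>" unfolding Q_def by auto
    then show ?thesis by blast
  next
    case (Dense \<delta> "is")
    obtain \<eta> where "set (\<delta> # is) \<subseteq> {..\<eta>}" using ex_list_bound by blast
    then have "T \<in> Q \<eta>" unfolding Q_def Dense by (auto simp: image_iff)
    then show ?thesis by blast
  qed
  then have "(\<Union>\<eta>. Q \<eta>) = UNIV" by blast
  then show ?thesis using q by auto
qed

text \<open>Diamond predicts one set of ordinals, whereas a guess contains sets of tuples of bounded
  sets. Each bounded set is replaced by an index at which the diamond sequence lists it, and each
  resulting token by an ordinal. Smallness of \<open>D\<close> at each fixed \<delta> keeps the
  codes belonging to \<delta> bounded.\<close>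

lemma ex_guess:
  assumes "diamond (t :: 'a itself)"
  obtains G :: "'a \<Rightarrow> 'a set list \<times> ('a \<times> 'a set) list \<times> ('a \<times> 'a set list) set" where
    "\<And>Bs xs D \<xi> g. length xs = length Bs \<Longrightarrow> (\<And>x. x \<in> set xs \<Longrightarrow> snd x \<subseteq> oset (fst x)) \<Longrightarrow>
       (\<And>\<delta> zs Z. (\<delta>, zs) \<in> D \<Longrightarrow> Z \<in> set zs \<Longrightarrow> Z \<subseteq> oset \<delta>) \<Longrightarrow>
       (\<And>\<delta>. small {zs. (\<delta>, zs) \<in> D}) \<Longrightarrow>
       \<exists>\<beta>. \<xi> < \<beta> \<and> (\<forall>\<eta><\<beta>. g \<eta> < \<beta>) \<and>
           G \<beta> = (map (\<lambda>B. B \<inter> oset \<beta>) Bs, xs, {(\<delta>, zs) \<in> D. \<delta> < \<beta>})"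
proof -
  obtain A :: "'a \<Rightarrow> 'a set" where A: "\<And>X. stationary {\<alpha>. X \<inter> oset \<alpha> = A \<alpha>}"
    using assms unfolding diamond_def by blast
  obtain p :: "'a token \<Rightarrow> 'a" where p: "inj p" using ex_inj_token by blast
  define c where "c X = (SOME \<beta>. A \<beta> = X)" for X
  \<comment> \<open>The diamond sequence lists every bounded set: such a set equals its own trace at
    any sufficiently late point where it is guessed.\<close>
  have c: "A (c X) = X" if "X \<subseteq> oset \<nu>" for X \<nu>
  proof -
    obtain \<beta> where "X \<inter> oset \<beta> = A \<beta>" "\<nu> < \<beta>"
      using stationary_closed_point[OF A[of X], of \<nu> id] by auto
    moreover have "X \<inter> oset \<beta> = X" using that \<open>\<nu> < \<beta>\<close> by auto
    ultimately have "A \<beta> = X" by simp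
    then show ?thesis unfolding c_def by (rule someI)
  qed
  define tok where "tok \<beta> = {w. p w \<in> A \<beta>}" for \<beta>
  \<comment> \<open>At a correct guess exactly one \<open>Start\<close> token is present, so the
    description is proper there; its value at other points does not matter.\<close>
  define start where "start \<beta> = (THE ps. Start ps \<in> tok \<beta>)" for \<beta>
  define G where "G \<beta> = (map (\<lambda>j. {\<xi>. Branch j \<xi> \<in> tok \<beta>}) [0..<length (start \<beta>)],
      map (\<lambda>(\<gamma>, i). (\<gamma>, A i)) (start \<beta>),
      {(\<delta>, map A is) |\<delta> is. Dense \<delta> is \<in> tok \<beta>})" for \<beta>
  show ?thesis
  proof (rule that[of G])
    fix Bs :: "'a set list" and xs :: "('a \<times> 'a set) list" and D :: "('a \<times> 'a set list) set"
      and \<xi> and g :: "'a \<Rightarrow> 'a"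
    assume len: "length xs = length Bs"
      and xs: "\<And>x. x \<in> set xs \<Longrightarrow> snd x \<subseteq> oset (fst x)"
      and D: "\<And>\<delta> zs Z. (\<delta>, zs) \<in> D \<Longrightarrow> Z \<in> set zs \<Longrightarrow> Z \<subseteq> oset \<delta>"
      and D_small: "\<And>\<delta>. small {zs. (\<delta>, zs) \<in> D}"
    define ps where "ps = map (\<lambda>(\<gamma>, X). (\<gamma>, c X)) xs"
    define W where "W = {Start ps} \<union> {Branch j \<xi> |j \<xi>. j < length Bs \<and> \<xi> \<in> Bs ! j}
        \<union> {Dense \<delta> (map c zs) |\<delta> zs. (\<delta>, zs) \<in> D}"
    \<comment> \<open>\<open>h\<close> reads off from a code the ordinal that the token speaks
      about. A point closed under \<open>h\<close> and under the codes collected in \<open>N\<close>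
      contains the code of a \<open>Branch\<close> or \<open>Dense\<close> token of \<open>W\<close>
      exactly when it contains that ordinal.\<close>
    define h where "h \<eta> = (case inv p \<eta> of Start _ \<Rightarrow> \<eta> | Branch j \<xi> \<Rightarrow> \<xi> | Dense \<delta> _ \<Rightarrow> \<delta>)" for \<eta>
    define N where "N \<eta> = {g \<eta>, h \<eta>} \<union> (\<lambda>j. p (Branch j \<eta>)) ` {..<length Bs}
        \<union> (\<lambda>zs. p (Dense \<eta> (map c zs))) ` {zs. (\<eta>, zs) \<in> D}" for \<eta>
    have "small (N \<eta>)" for \<eta>
      unfolding N_def by (intro small_Un small_image D_small) (auto intro!: small_finite)
    then have N: "y < bound (N \<eta>)" if "y \<in> N \<eta>" for y \<eta> using bound that by blast
    \<comment> \<open>The code of the \<open>Start\<close> token has to be put below \<beta>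
      explicitly, since no closure condition produces it.\<close>
    obtain \<beta> where guess: "p ` W \<inter> oset \<beta> = A \<beta>" and \<beta>: "max \<xi> (p (Start ps)) < \<beta>"
      and closed: "\<And>\<eta>. \<eta> < \<beta> \<Longrightarrow> bound (N \<eta>) < \<beta>"
      using stationary_closed_point[OF A[of "p ` W"], of "max \<xi> (p (Start ps))" "\<lambda>\<eta>. bound (N \<eta>)"]
      by (metis (mono_tags, lifting) mem_Collect_eq)
    have N\<beta>: "y < \<beta>" if "y \<in> N \<eta>" "\<eta> < \<beta>" for y \<eta>
      using N closed that by (meson less_trans)
    have tok: "w \<in> tok \<beta> \<longleftrightarrow> w \<in> W \<and> p w < \<beta>" for w
      unfolding tok_def guess[symmetric] using p by (auto dest: injD)
    have start: "start \<beta> = ps"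
      unfolding start_def tok W_def using \<beta> by auto
    have branch: "Branch j \<xi> \<in> tok \<beta> \<longleftrightarrow> \<xi> \<in> Bs ! j \<inter> oset \<beta>" if "j < length Bs" for j \<xi>
    proof -
      have "\<xi> < \<beta>" if "p (Branch j \<xi>) < \<beta>"
        using N\<beta>[of "h (p (Branch j \<xi>))", OF _ that] p by (simp add: N_def h_def)
      moreover have "p (Branch j \<xi>) < \<beta>" if "\<xi> < \<beta>"
        using N\<beta>[of "p (Branch j \<xi>)", OF _ that] \<open>j < length Bs\<close> by (simp add: N_def)
      ultimately show ?thesis unfolding tok W_def using that by auto
    qed
    have dense: "Dense \<delta> is \<in> tok \<beta> \<longleftrightarrow> \<delta> < \<beta> \<and> (\<exists>zs. (\<delta>, zs) \<in> D \<and> is = map c zs)" for \<delta> "is"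
    proof -
      have "\<delta> < \<beta>" if "p (Dense \<delta> is) < \<beta>"
        using N\<beta>[of "h (p (Dense \<delta> is))", OF _ that] p by (simp add: N_def h_def)
      moreover have "p (Dense \<delta> (map c zs)) < \<beta>" if "\<delta> < \<beta>" "(\<delta>, zs) \<in> D" for zs
        using N\<beta>[of "p (Dense \<delta> (map c zs))", OF _ \<open>\<delta> < \<beta>\<close>] that by (simp add: N_def)
      ultimately show ?thesis unfolding tok W_def by auto
    qed
    have "map (\<lambda>j. {\<xi>. Branch j \<xi> \<in> tok \<beta>}) [0..<length ps] = map (\<lambda>B. B \<inter> oset \<beta>) Bs"
      using branch by (intro nth_equalityI) (auto simp: ps_def len)
    moreover have "map (\<lambda>(\<gamma>, i). (\<gamma>, A i)) ps = xs"
      unfolding ps_def map_map by (intro map_idI) (simp add: case_prod_beta c[OF xs])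
    moreover have "map A (map c zs) = zs" if "(\<delta>, zs) \<in> D" for \<delta> zs
      unfolding map_map by (intro map_idI) (simp add: c[OF D[OF that]])
    then have "{(\<delta>, map A is) |\<delta> is. Dense \<delta> is \<in> tok \<beta>} = {(\<delta>, zs) \<in> D. \<delta> < \<beta>}"
      unfolding dense by force
    ultimately have "G \<beta> = (map (\<lambda>B. B \<inter> oset \<beta>) Bs, xs, {(\<delta>, zs) \<in> D. \<delta> < \<beta>})"
      unfolding G_def start by simp
    moreover have "g \<eta> < \<beta>" if "\<eta> < \<beta>" for \<eta>
      using N\<beta>[of "g \<eta>", OF _ that] by (simp add: N_def)
    ultimately show "\<exists>\<beta>. \<xi> < \<beta> \<and> (\<forall>\<eta><\<beta>. g \<eta> < \<beta>) \<and>
           G \<beta> = (map (\<lambda>B. B \<inter> oset \<beta>) Bs, xs, {(\<delta>, zs) \<in> D. \<delta> < \<beta>})"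
      using \<beta> by auto
  qed
qed

end

section \<open>Levels from coherent ladders\<close>

locale proxy_construction = regular_cardinal \<kappa> for \<kappa> :: "'a::wellorder rel" +
  fixes C :: "'a \<Rightarrow> 'a set"
    and G :: "'a \<Rightarrow> 'a set list \<times> ('a \<times> 'a set) list \<times> ('a \<times> 'a set list) set"
  assumes C_closed: "\<And>\<alpha>. closed_subset_of (C \<alpha>) \<alpha>"
    and C_sup: "\<And>\<alpha>. osup (C \<alpha>) = osup (oset \<alpha>)"
    and C_coherent: "\<And>\<alpha> \<alpha>'. \<alpha>' \<in> acc (C \<alpha>) \<Longrightarrow> C \<alpha>' = C \<alpha> \<inter> oset \<alpha>'"
    and C_hits: "\<And>B :: 'a \<Rightarrow> 'a set. (\<And>i. unbounded (B i)) \<Longrightarrow>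
      stationary {\<alpha>. \<forall>i < \<alpha>. \<forall>n::nat. osup {\<beta> \<in> C \<alpha>. suc_n n (C \<alpha> - oset \<beta>) \<subseteq> B i} = \<alpha>}"
    and guess: "\<And>Bs xs D \<xi> g. length xs = length Bs \<Longrightarrow>
       (\<And>x. x \<in> set xs \<Longrightarrow> snd x \<subseteq> oset (fst x)) \<Longrightarrow>
       (\<And>\<delta> zs Z. (\<delta>, zs) \<in> D \<Longrightarrow> Z \<in> set zs \<Longrightarrow> Z \<subseteq> oset \<delta>) \<Longrightarrow>
       (\<And>\<delta>. small {zs. (\<delta>, zs) \<in> D}) \<Longrightarrow>
       \<exists>\<beta>. \<xi> < \<beta> \<and> (\<forall>\<eta><\<beta>. g \<eta> < \<beta>) \<and>
           G \<beta> = (map (\<lambda>B. B \<inter> oset \<beta>) Bs, xs, {(\<delta>, zs) \<in> D. \<delta> < \<beta>})"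
begin

lemma C_subset: "C \<alpha> \<subseteq> oset \<alpha>"
  using C_closed unfolding closed_subset_of_def by blast

text \<open>Below, a pair in \<open>'a \<times> 'a set\<close> is a starting node with its height, \<open>b\<close> is the predecessor
of \<open>\<beta>\<close> on the ladder, and \<open>p x F\<close> is the value at \<open>b\<close> of the branch that starts at \<open>x\<close> in the tree
of trace \<open>F\<close>. The choice of \<open>ys\<close> in \<open>step\<close> depends only on \<open>\<beta>\<close>, the guess and \<open>p\<close>, so the
branches of different guessed traces move to the same tuple.\<close>

definition hits :: "('a set \<Rightarrow> 'a set set) \<Rightarrow> 'a \<Rightarrow> 'a \<Rightarrow> ('a \<times> 'a set \<Rightarrow> 'a set \<Rightarrow> 'a set) \<Rightarrow>
    'a set list \<Rightarrow> ('a \<times> 'a set) list \<Rightarrow> ('a \<times> 'a set list) set \<Rightarrow> 'a set list \<Rightarrow> bool" where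
  "hits l \<beta> b p Bs xs D ys \<longleftrightarrow> length ys = length Bs \<and>
     (\<forall>k < length Bs. ys ! k \<in> l (Bs ! k) \<and> ys ! k \<inter> oset b = p (xs ! k) (Bs ! k)) \<and>
     (\<exists>\<delta>\<le>\<beta>. (\<delta>, map (\<lambda>Y. Y \<inter> oset \<delta>) ys) \<in> D)"

definition step :: "('a set \<Rightarrow> 'a set set) \<Rightarrow> 'a \<Rightarrow> 'a \<Rightarrow> ('a \<times> 'a set \<Rightarrow> 'a set \<Rightarrow> 'a set) \<Rightarrow>
    'a \<times> 'a set \<Rightarrow> 'a set \<Rightarrow> 'a set" where
  "step l \<beta> b p x E = (case G \<beta> of (Bs, xs, D) \<Rightarrow>
     if distinct Bs \<and> (\<exists>j < length Bs. Bs ! j = E \<inter> oset \<beta> \<and> xs ! j = x) \<and>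
        (\<exists>ys. hits l \<beta> b p Bs xs D ys)
     then (SOME ys. hits l \<beta> b p Bs xs D ys) ! (LEAST j. j < length Bs \<and> Bs ! j = E \<inter> oset \<beta>)
     else SOME Y. Y \<in> l E \<and> Y \<inter> oset b = p x E)"

text \<open>The canonical branch along the ladder \<open>D\<close>. At each \<beta> the recursion
  returns a function of all starting nodes and all traces at once, because \<open>step\<close> for
  one trace consults the branches of the other guessed traces. Away from limits of the ladder,
  \<open>osup (D \<inter> oset \<beta>)\<close> is the preceding ladder point.\<close>

function path :: "('a \<Rightarrow> 'a set \<Rightarrow> 'a set set) \<Rightarrow> 'a set \<Rightarrow> 'a \<Rightarrow> 'a \<times> 'a set \<Rightarrow> 'a set \<Rightarrow> 'a set" where
  "path l D \<beta> = (\<lambda>x E.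
     if \<beta> \<le> fst x then snd x
     else if osup (D \<inter> oset \<beta>) = \<beta> then (\<Union>\<delta>\<in>{\<delta> \<in> D. fst x \<le> \<delta> \<and> \<delta> < \<beta>}. path l D \<delta> x E)
     else step (l \<beta>) \<beta> (osup (D \<inter> oset \<beta>)) (path l D (osup (D \<inter> oset \<beta>))) x E)"
  by pat_completeness auto
termination
proof (relation "inv_image {(x, y). x < y} (\<lambda>(l, D, \<beta>). \<beta> :: 'a)")
  show "wf (inv_image {(x, y). x < y} (\<lambda>(l :: 'a \<Rightarrow> 'a set \<Rightarrow> 'a set set, D :: 'a set, \<beta>). \<beta> :: 'a))"
    by (intro wf_inv_image wf)
qed (auto simp: less_le intro!: osup_least)

declare path.simps [simp del]

lemma path_start: "path l D \<gamma> (\<gamma>, X) E = X"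
  by (simp add: path.simps)

lemma path_acc:
  assumes "osup (D \<inter> oset \<beta>) = \<beta>" "\<gamma> < \<beta>"
  shows "path l D \<beta> (\<gamma>, X) E = (\<Union>\<delta>\<in>{\<delta> \<in> D. \<gamma> \<le> \<delta> \<and> \<delta> < \<beta>}. path l D \<delta> (\<gamma>, X) E)"
  unfolding path.simps[of l D \<beta>] using assms by (simp add: not_le[symmetric])

lemma path_nacc:
  assumes "osup (D \<inter> oset \<beta>) = b" "b \<noteq> \<beta>" "\<gamma> < \<beta>"
  shows "path l D \<beta> (\<gamma>, X) E = step (l \<beta>) \<beta> b (path l D b) (\<gamma>, X) E"
  unfolding path.simps[of l D \<beta>] using assms by (simp add: not_le[symmetric])

text \<open>A set of ordinals below \<alpha> stands for a 0-1 sequence of length \<alpha>, so a node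
  has two immediate successors, without and with the new point \<open>b\<close>. The test
  \<open>b < \<alpha>\<close> holds exactly at successors. A limit level keeps only the canonical
  branches along \<open>C \<alpha>\<close>, which makes it small.\<close>

definition lev_step :: "('a \<Rightarrow> 'a set \<Rightarrow> 'a set set) \<Rightarrow> 'a \<Rightarrow> 'a set \<Rightarrow> 'a set set" where
  "lev_step l \<alpha> E = (let b = osup (oset \<alpha>) in
     if b < \<alpha> then l b E \<union> insert b ` l b E
     else if \<alpha> = ozero then {{}}
     else \<Union>\<gamma>\<in>C \<alpha>. (\<lambda>X. path l (C \<alpha>) \<alpha> (\<gamma>, X) E) ` l \<gamma> E)"

text \<open>The second argument of \<open>lev \<alpha>\<close> matters only through its trace on \<open>\<alpha>\<close>, so \<open>lev \<alpha> B\<close>, for a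
member \<open>B\<close> of the Kurepa family, is level \<open>\<alpha>\<close> of the tree attached to \<open>B\<close>.\<close>

definition lev :: "'a \<Rightarrow> 'a set \<Rightarrow> 'a set set" where
  "lev = wfrec {(x, y). x < y} (\<lambda>l \<alpha> E. lev_step l \<alpha> (E \<inter> oset \<alpha>))"

text \<open>A path up to \<beta> looks at levels below \<beta>, and at level \<beta> itself only
  when \<beta> is not a limit of the ladder. This justifies the recursion for \<open>lev\<close>,
  and it lets a path along one ladder be read as a path along a coherent one.\<close>

lemma path_cong:
  "(\<And>\<delta>. \<delta> < \<beta> \<Longrightarrow> l \<delta> = l' \<delta>) \<Longrightarrow> osup (D \<inter> oset \<beta>) = \<beta> \<or> l \<beta> = l' \<beta> \<Longrightarrow>
     D \<inter> oset \<beta> = D' \<inter> oset \<beta> \<Longrightarrow> path l D \<beta> = path l' D' \<beta>"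
proof (induction \<beta> rule: less_induct)
  case (less \<beta>)
  have IH: "path l D \<delta> = path l' D' \<delta>" if "\<delta> < \<beta>" for \<delta>
    using less.prems that by (intro less.IH) auto
  have "{\<delta> \<in> D. \<gamma> \<le> \<delta> \<and> \<delta> < \<beta>} = {\<delta> \<in> D'. \<gamma> \<le> \<delta> \<and> \<delta> < \<beta>}" for \<gamma>
    using less.prems(3) by auto
  moreover have "osup (D \<inter> oset \<beta>) \<noteq> \<beta> \<Longrightarrow> osup (D \<inter> oset \<beta>) < \<beta>"
    using osup_le_bound[of "D \<inter> oset \<beta>" \<beta>] by auto
  ultimately show ?case
    using IH less.prems(2) unfolding path.simps[of l D \<beta>] path.simps[of l' D' \<beta>] less.prems(3)[symmetric]
    by (intro ext) auto
qed

lemma lev_unfold: "lev \<alpha> E = lev_step lev \<alpha> (E \<inter> oset \<alpha>)"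
proof -
  define l where "l = cut lev {(x, y). x < y} \<alpha>"
  have l: "l \<gamma> = lev \<gamma>" if "\<gamma> < \<alpha>" for \<gamma>
    unfolding l_def using that by (simp add: cut_apply)
  have "lev \<alpha> E = lev_step l \<alpha> (E \<inter> oset \<alpha>)"
    unfolding lev_def l_def by (subst wfrec[OF wf]) simp
  also have "\<dots> = lev_step lev \<alpha> (E \<inter> oset \<alpha>)"
  proof (cases "osup (oset \<alpha>) < \<alpha>")
    case True
    then show ?thesis using l by (simp add: lev_step_def Let_def)
  next
    case False
    then have "osup (oset \<alpha>) = \<alpha>" using osup_le_bound[of "oset \<alpha>" \<alpha>] by auto
    moreover have "C \<alpha> \<inter> oset \<alpha> = C \<alpha>" using C_subset by auto
    \<comment> \<open>The ladder accumulates at a limit \<alpha>, so level \<alpha>, which the cut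
      function \<open>l\<close> does not know, is never consulted.\<close>
    ultimately have "path l (C \<alpha>) \<alpha> = path lev (C \<alpha>) \<alpha>"
      using l C_sup by (intro path_cong) auto
    moreover have "l \<gamma> = lev \<gamma>" if "\<gamma> \<in> C \<alpha>" for \<gamma> using l that C_subset by blast
    ultimately show ?thesis using False by (simp add: lev_step_def Let_def)
  qed
  finally show ?thesis .
qed

lemma lev_cong: "E \<inter> oset \<alpha> = E' \<inter> oset \<alpha> \<Longrightarrow> lev \<alpha> E = lev \<alpha> E'"
  by (simp add: lev_unfold)

lemma lev_trace: "\<alpha> \<le> \<gamma> \<Longrightarrow> lev \<alpha> (E \<inter> oset \<gamma>) = lev \<alpha> E"
  by (rule lev_cong) auto

text \<open>Reconciles two indexings: guesses name traces on \<beta>, while branches are followed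
  for full members of the family.\<close>

lemma path_trace:
  "E \<inter> oset \<beta> = E' \<inter> oset \<beta> \<Longrightarrow> path lev D \<beta> x E = path lev D \<beta> x E'"
proof (induction \<beta> arbitrary: x E E' rule: less_induct)
  case (less \<beta>)
  have IH: "path lev D \<delta> x E = path lev D \<delta> x E'" if "\<delta> < \<beta>" for \<delta>
  proof (rule less.IH[OF that])
    have "E \<inter> oset \<delta> = (E \<inter> oset \<beta>) \<inter> oset \<delta>" using that by auto
    also have "\<dots> = E' \<inter> oset \<delta>" unfolding less.prems using that by auto
    finally show "E \<inter> oset \<delta> = E' \<inter> oset \<delta>" .
  qed
  have "step (lev \<beta>) \<beta> b (path lev D b) x E = step (lev \<beta>) \<beta> b (path lev D b) x E'"
    if "b < \<beta>" for b
    unfolding step_def less.prems lev_cong[OF less.prems] IH[OF that] ..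
  moreover have "osup (D \<inter> oset \<beta>) \<noteq> \<beta> \<Longrightarrow> osup (D \<inter> oset \<beta>) < \<beta>"
    using osup_le_bound[of "D \<inter> oset \<beta>" \<beta>] by auto
  ultimately show ?case using IH unfolding path.simps[of lev D \<beta>] by auto
qed

lemma lev_zero: "lev ozero E = {{}}"
  using ozero_le[of "osup (oset ozero)"]
  by (simp add: lev_unfold[of ozero] lev_step_def Let_def leD)

lemma oset_successor:
  assumes "osup (oset (\<alpha>::'a)) = b" "b < \<alpha>"
  shows "oset \<alpha> = insert b (oset b)"
  using assms osup_ge[of "oset \<alpha>" \<alpha>] by fastforce

lemma lev_successor:
  assumes "osup (oset \<alpha>) = b" "b < \<alpha>"
  shows "lev \<alpha> E = lev b E \<union> insert b ` lev b E"
  using assms lev_trace[of b \<alpha>] by (simp add: lev_unfold[of \<alpha>] lev_step_def Let_def)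

lemma lev_limit:
  assumes "osup (oset \<alpha>) = \<alpha>" "\<alpha> \<noteq> ozero"
  shows "lev \<alpha> E = (\<Union>\<gamma>\<in>C \<alpha>. (\<lambda>X. path lev (C \<alpha>) \<alpha> (\<gamma>, X) E) ` lev \<gamma> E)"
proof -
  have "lev \<gamma> (E \<inter> oset \<alpha>) = lev \<gamma> E" if "\<gamma> \<in> C \<alpha>" for \<gamma>
    using C_subset that by (intro lev_trace) (meson mem_Collect_eq less_imp_le subsetD)
  moreover have "path lev (C \<alpha>) \<alpha> x (E \<inter> oset \<alpha>) = path lev (C \<alpha>) \<alpha> x E" for x
    by (rule path_trace) auto
  ultimately show ?thesis
    using assms by (simp add: lev_unfold[of \<alpha>] lev_step_def Let_def)
qed

text \<open>Distinct guessed traces leave only one possible coordinate for \<open>E\<close>, so the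
  \<open>LEAST\<close> in \<open>step\<close> returns it.\<close>

lemma step_hit:
  assumes G: "G \<beta> = (Bs, xs, D)" and "distinct Bs" "\<exists>ys. hits l \<beta> b p Bs xs D ys"
    and j: "j < length Bs" "Bs ! j = E \<inter> oset \<beta>" "xs ! j = x"
  shows "step l \<beta> b p x E = (SOME ys. hits l \<beta> b p Bs xs D ys) ! j"
proof -
  have uniq: "i = j" if "i < length Bs" "Bs ! i = E \<inter> oset \<beta>" for i
    using assms that by (metis nth_eq_iff_index_eq)
  have "(LEAST j. j < length Bs \<and> Bs ! j = E \<inter> oset \<beta>) = j"
  proof (rule Least_equality)
    show "j < length Bs \<and> Bs ! j = E \<inter> oset \<beta>" using j by blast
  next
    fix i assume "i < length Bs \<and> Bs ! i = E \<inter> oset \<beta>"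
    then show "j \<le> i" using uniq[of i] by simp
  qed
  then show ?thesis using assms unfolding step_def by auto
qed

text \<open>Holds whether the guess is right or wrong: a successful guess only selects among tuples
  of extensions that lie in the levels, and otherwise an arbitrary extension in the level is
  taken.\<close>

lemma step_extends:
  assumes ext: "\<And>F X. X \<in> lev b F \<Longrightarrow> \<exists>Y\<in>lev \<beta> F. Y \<inter> oset b = X"
    and p: "p x E \<in> lev b E" "p x (E \<inter> oset \<beta>) = p x E"
  shows "step (lev \<beta>) \<beta> b p x E \<in> lev \<beta> E \<and> step (lev \<beta>) \<beta> b p x E \<inter> oset b = p x E"
proof -
  obtain Bs xs D where G: "G \<beta> = (Bs, xs, D)" by (cases "G \<beta>") auto
  show ?thesis
  proof (cases "distinct Bs \<and> (\<exists>j < length Bs. Bs ! j = E \<inter> oset \<beta> \<and> xs ! j = x) \<and>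
        (\<exists>ys. hits (lev \<beta>) \<beta> b p Bs xs D ys)")
    case True
    then obtain j where j: "j < length Bs" "Bs ! j = E \<inter> oset \<beta>" "xs ! j = x" by blast
    define ys where "ys = (SOME ys. hits (lev \<beta>) \<beta> b p Bs xs D ys)"
    have "step (lev \<beta>) \<beta> b p x E = ys ! j"
      unfolding ys_def using True j by (intro step_hit[OF G]) auto
    moreover have "hits (lev \<beta>) \<beta> b p Bs xs D ys"
      unfolding ys_def using True by (blast intro: someI_ex)
    ultimately show ?thesis
      using j p lev_trace[of \<beta> \<beta>] unfolding hits_def by auto
  next
    case False
    have "step (lev \<beta>) \<beta> b p x E = (SOME Y. Y \<in> lev \<beta> E \<and> Y \<inter> oset b = p x E)"
      unfolding step_def G prod.case if_not_P[OF False] ..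
    then show ?thesis
      using someI_ex[of "\<lambda>Y. Y \<in> lev \<beta> E \<and> Y \<inter> oset b = p x E"] ext[OF p(1)] by auto
  qed
qed

lemma UN_coherent:
  assumes "\<delta> \<in> S" "\<And>\<delta>. \<delta> \<in> S \<Longrightarrow> P \<delta> \<subseteq> oset \<delta>"
    and "\<And>\<delta> \<delta>'. \<delta> \<in> S \<Longrightarrow> \<delta>' \<in> S \<Longrightarrow> \<delta> \<le> \<delta>' \<Longrightarrow> P \<delta>' \<inter> oset \<delta> = P \<delta>"
  shows "(\<Union>\<delta>'\<in>S. P \<delta>') \<inter> oset \<delta> = P (\<delta>::'a)"
proof
  show "(\<Union>\<delta>'\<in>S. P \<delta>') \<inter> oset \<delta> \<subseteq> P \<delta>"
  proof clarify
    fix x \<delta>' assume *: "x < \<delta>" "\<delta>' \<in> S" "x \<in> P \<delta>'"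
    show "x \<in> P \<delta>"
      using assms(3)[of \<delta> \<delta>'] assms(3)[of \<delta>' \<delta>] assms(1) * linear[of \<delta> \<delta>'] by blast
  qed
qed (use assms(1,2) in blast)

lemma C_pred:
  assumes "\<beta> \<in> C \<alpha>" "\<gamma> \<in> C \<alpha>" "\<gamma> < \<beta>" and b: "osup (C \<alpha> \<inter> oset \<beta>) = b" "b \<noteq> \<beta>"
  shows "b \<in> C \<alpha>" "\<gamma> \<le> b" "b < \<beta>" "\<And>\<delta>. \<delta> \<in> C \<alpha> \<Longrightarrow> \<delta> < \<beta> \<Longrightarrow> \<delta> \<le> b"
proof -
  have le: "\<delta> \<le> b" if "\<delta> \<in> C \<alpha>" "\<delta> < \<beta>" for \<delta>
    using osup_ge[of "C \<alpha> \<inter> oset \<beta>" \<beta> \<delta>] that b by auto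
  show "b < \<beta>" using osup_le_bound[of "C \<alpha> \<inter> oset \<beta>" \<beta>] b by auto
  show "\<gamma> \<le> b" using le assms by blast
  show "b \<in> C \<alpha>"
  proof (rule ccontr)
    \<comment> \<open>Then all ladder points below \<beta> are below \<open>b\<close>, so
      \<open>b\<close> is a limit of the ladder and closedness puts it back. The point \<gamma>
      excludes the case that \<open>b\<close> is zero.\<close>
    assume "b \<notin> C \<alpha>"
    then have "\<delta> < b" if "\<delta> \<in> C \<alpha>" "\<delta> < \<beta>" for \<delta>
      using le[OF that] that by (cases "\<delta> = b") auto
    then have "C \<alpha> \<inter> oset b = C \<alpha> \<inter> oset \<beta>" "\<gamma> < b"
      using \<open>b < \<beta>\<close> assms by auto
    moreover have "ozero < b" using \<open>\<gamma> < b\<close> ozero_le[of \<gamma>] by (rule le_less_trans[rotated])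
    moreover have "b < \<alpha>" using \<open>b < \<beta>\<close> assms(1) C_subset by (meson mem_Collect_eq less_trans subsetD)
    ultimately show False
      using C_closed[of \<alpha>] b \<open>b \<notin> C \<alpha>\<close> unfolding closed_subset_of_def by metis
  qed
  show "\<And>\<delta>. \<delta> \<in> C \<alpha> \<Longrightarrow> \<delta> < \<beta> \<Longrightarrow> \<delta> \<le> b" by (rule le)
qed

text \<open>The induction hypothesis for level \<alpha>: paths stay inside levels only if the levels
  below already restrict and extend, and limit levels are in turn made of paths.\<close>

definition coherent_below :: "'a \<Rightarrow> bool" where
  "coherent_below \<alpha> \<longleftrightarrow> (\<forall>\<beta><\<alpha>. \<forall>E.
     (\<forall>X\<in>lev \<beta> E. X \<subseteq> oset \<beta> \<and> (\<forall>\<gamma>\<le>\<beta>. X \<inter> oset \<gamma> \<in> lev \<gamma> E)) \<and>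
     (\<forall>\<gamma>\<le>\<beta>. \<forall>X\<in>lev \<gamma> E. \<exists>Y\<in>lev \<beta> E. Y \<inter> oset \<gamma> = X))"

text \<open>At an accumulation point \<beta> of the ladder, coherence gives
  \<open>C \<beta> = C \<alpha> \<inter> oset \<beta>\<close>, so the path is one of those from
  which level \<beta> was defined. At any other ladder point the step itself lands in the
  level.\<close>

lemma path_in_lev:
  assumes IH: "coherent_below \<alpha>" and \<gamma>: "\<gamma> \<in> C \<alpha>" and X: "X \<in> lev \<gamma> E"
  shows "\<beta> \<in> C \<alpha> \<Longrightarrow> \<gamma> \<le> \<beta> \<Longrightarrow> path lev (C \<alpha>) \<beta> (\<gamma>, X) E \<in> lev \<beta> E \<and>
     (\<forall>\<delta>\<in>C \<alpha>. \<gamma> \<le> \<delta> \<and> \<delta> \<le> \<beta> \<longrightarrow>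
        path lev (C \<alpha>) \<beta> (\<gamma>, X) E \<inter> oset \<delta> = path lev (C \<alpha>) \<delta> (\<gamma>, X) E)"
proof (induction \<beta> rule: less_induct)
  case (less \<beta>)
  let ?P = "\<lambda>\<beta>. path lev (C \<alpha>) \<beta> (\<gamma>, X) E"
  have below: "\<delta> < \<alpha>" if "\<delta> \<in> C \<alpha>" for \<delta> using C_subset that by blast
  have sub: "Y \<subseteq> oset \<delta>" if "\<delta> \<in> C \<alpha>" "Y \<in> lev \<delta> E" for \<delta> Y
    using IH below that unfolding coherent_below_def by blast
  consider "\<gamma> = \<beta>" | "\<gamma> < \<beta>" "osup (C \<alpha> \<inter> oset \<beta>) = \<beta>" | "\<gamma> < \<beta>" "osup (C \<alpha> \<inter> oset \<beta>) \<noteq> \<beta>"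
    using less.prems by fastforce
  then show ?case
  proof cases
    case 1
    then show ?thesis using X sub[OF \<gamma> X] by (auto simp: path_start)
  next
    case 2
    let ?S = "{\<delta> \<in> C \<alpha>. \<gamma> \<le> \<delta> \<and> \<delta> < \<beta>}"
    have pos: "ozero < \<beta>" using 2(1) ozero_le[of \<gamma>] by (rule le_less_trans[rotated])
    have "\<beta> \<in> acc (C \<alpha>)" using less.prems 2 pos unfolding acc_def by blast
    then have C\<beta>: "C \<beta> = C \<alpha> \<inter> oset \<beta>" by (rule C_coherent)
    have lim: "osup (oset \<beta>) = \<beta>" using C_sup[of \<beta>] C\<beta> 2 by simp
    have "?P \<beta> = path lev (C \<beta>) \<beta> (\<gamma>, X) E"
      using C\<beta> by (subst path_cong[of \<beta> lev lev "C \<alpha>" "C \<beta>"]) auto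
    then have "?P \<beta> \<in> lev \<beta> E"
      using lev_limit[OF lim, of E] pos C\<beta> \<gamma> 2 X by auto
    moreover have "?P \<beta> \<inter> oset \<delta> = ?P \<delta>" if "\<delta> \<in> C \<alpha>" "\<gamma> \<le> \<delta>" "\<delta> < \<beta>" for \<delta>
    proof -
      have "?P \<beta> = (\<Union>\<delta>\<in>?S. ?P \<delta>)" using 2 by (intro path_acc)
      also have "\<dots> \<inter> oset \<delta> = ?P \<delta>"
        using that less.IH sub by (intro UN_coherent) auto
      finally show ?thesis .
    qed
    moreover have "?P \<beta> \<inter> oset \<beta> = ?P \<beta>" using sub less.prems(1) calculation(1) by blast
    ultimately show ?thesis by (metis le_less)
  next
    case 3
    define b where "b = osup (C \<alpha> \<inter> oset \<beta>)"
    note b = C_pred[OF less.prems(1) \<gamma> 3(1) b_def[symmetric], folded b_def, OF 3(2)[folded b_def]]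
    have IHb: "?P b \<in> lev b E" "\<And>\<delta>. \<delta> \<in> C \<alpha> \<Longrightarrow> \<gamma> \<le> \<delta> \<Longrightarrow> \<delta> \<le> b \<Longrightarrow> ?P b \<inter> oset \<delta> = ?P \<delta>"
      using less.IH[OF b(3) b(1) b(2)] by blast+
    have P\<beta>: "?P \<beta> = step (lev \<beta>) \<beta> b (path lev (C \<alpha>) b) (\<gamma>, X) E"
      using 3 by (intro path_nacc) (auto simp: b_def)
    have "path lev (C \<alpha>) b (\<gamma>, X) (E \<inter> oset \<beta>) = ?P b"
      by (rule path_trace) (use b in auto)
    then have ext: "?P \<beta> \<in> lev \<beta> E \<and> ?P \<beta> \<inter> oset b = ?P b"
      unfolding P\<beta> using IH below[OF less.prems(1)] b(3) IHb(1)
      by (intro step_extends) (auto simp: coherent_below_def)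
    have "?P \<beta> \<inter> oset \<delta> = ?P \<delta>" if \<delta>: "\<delta> \<in> C \<alpha>" "\<gamma> \<le> \<delta>" "\<delta> \<le> \<beta>" for \<delta>
    proof (cases "\<delta> = \<beta>")
      case True
      then show ?thesis using ext sub less.prems(1) by blast
    next
      case False
      then have "\<delta> \<le> b" using \<delta> b(4) by auto
      then have "?P \<beta> \<inter> oset \<delta> = ?P \<beta> \<inter> oset b \<inter> oset \<delta>" by auto
      then show ?thesis using ext IHb(2)[OF \<delta>(1,2) \<open>\<delta> \<le> b\<close>] by simp
    qed
    then show ?thesis using ext by blast
  qed
qed

text \<open>The point \<alpha> is not on its own ladder, so its case is not an instance of
  \<open>path_in_lev\<close>; the union of the coherent values below takes its place.\<close>

lemma path_limit:
  assumes IH: "coherent_below \<alpha>" and lim: "osup (oset \<alpha>) = \<alpha>"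
    and \<gamma>: "\<gamma> \<in> C \<alpha>" and X: "X \<in> lev \<gamma> E" and \<delta>: "\<delta> \<in> C \<alpha>" "\<gamma> \<le> \<delta>"
  shows "path lev (C \<alpha>) \<alpha> (\<gamma>, X) E \<inter> oset \<delta> = path lev (C \<alpha>) \<delta> (\<gamma>, X) E"
proof -
  let ?P = "\<lambda>\<beta>. path lev (C \<alpha>) \<beta> (\<gamma>, X) E" and ?S = "{\<delta> \<in> C \<alpha>. \<gamma> \<le> \<delta> \<and> \<delta> < \<alpha>}"
  have below: "\<delta> < \<alpha>" if "\<delta> \<in> C \<alpha>" for \<delta> using C_subset that by blast
  have sub: "Y \<subseteq> oset \<delta>" if "\<delta> \<in> C \<alpha>" "Y \<in> lev \<delta> E" for \<delta> Y
    using IH below that unfolding coherent_below_def by blast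
  have "osup (C \<alpha> \<inter> oset \<alpha>) = \<alpha>"
    using C_sup[of \<alpha>] C_subset[of \<alpha>] lim by (simp add: inf.absorb1)
  then have "?P \<alpha> = (\<Union>\<delta>\<in>?S. ?P \<delta>)" using below[OF \<gamma>] by (rule path_acc)
  also have "\<dots> \<inter> oset \<delta> = ?P \<delta>"
    using \<delta> below sub path_in_lev[OF IH \<gamma> X] by (intro UN_coherent) auto
  finally show ?thesis .
qed

lemma C_unbounded:
  assumes "osup (oset \<alpha>) = \<alpha>" "\<xi> < \<alpha>"
  shows "\<exists>\<delta>\<in>C \<alpha>. \<xi> < \<delta>"
  using less_osup[OF C_subset, of \<xi>] C_sup assms by simp

lemma lev_coherent:
  "(\<forall>X\<in>lev \<alpha> E. X \<subseteq> oset \<alpha> \<and> (\<forall>\<gamma>\<le>\<alpha>. X \<inter> oset \<gamma> \<in> lev \<gamma> E)) \<and>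
   (\<forall>\<gamma>\<le>\<alpha>. \<forall>X\<in>lev \<gamma> E. \<exists>Y\<in>lev \<alpha> E. Y \<inter> oset \<gamma> = X)"
proof (induction \<alpha> arbitrary: E rule: less_induct)
  case (less \<alpha>)
  have IH: "coherent_below \<alpha>"
    unfolding coherent_below_def by (intro allI impI) (rule less.IH)
  have sub: "X \<subseteq> oset \<beta>" and restr: "\<And>\<gamma>. \<gamma> \<le> \<beta> \<Longrightarrow> X \<inter> oset \<gamma> \<in> lev \<gamma> E"
    if "\<beta> < \<alpha>" "X \<in> lev \<beta> E" for \<beta> X
    using less.IH[OF that(1), of E] that(2) by simp_all
  have ext: "\<exists>Y\<in>lev \<beta> E. Y \<inter> oset \<gamma> = X" if "\<beta> < \<alpha>" "\<gamma> \<le> \<beta>" "X \<in> lev \<gamma> E" for \<beta> \<gamma> X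
    using less.IH[OF that(1), of E] that(2,3) by simp
  have "X \<subseteq> oset \<alpha> \<and> (\<forall>\<gamma><\<alpha>. X \<inter> oset \<gamma> \<in> lev \<gamma> E)" if X: "X \<in> lev \<alpha> E" for X
  proof (cases "osup (oset \<alpha>) < \<alpha>")
    case True
    then obtain b where b': "osup (oset \<alpha>) = b" "b < \<alpha>" by blast
    note b = b'(2) oset_successor[OF b']
    obtain Y where Y: "Y \<in> lev b E" "X = Y \<or> X = insert b Y"
      using X unfolding lev_successor[OF b'] by blast
    have "X \<inter> oset \<gamma> = Y \<inter> oset \<gamma> \<and> \<gamma> \<le> b" if "\<gamma> < \<alpha>" for \<gamma>
    proof -
      have "\<gamma> \<in> insert b (oset b)" using that unfolding b(2)[symmetric] by simp
      then have "\<gamma> \<le> b" by auto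
      then have "b \<notin> oset \<gamma>" by (simp add: not_less)
      then show ?thesis using Y(2) \<open>\<gamma> \<le> b\<close> by blast
    qed
    moreover have "X \<subseteq> oset \<alpha>" using Y(2) sub[OF b(1) Y(1)] unfolding b(2) by blast
    ultimately show ?thesis using restr[OF b(1) Y(1)] by metis
  next
    case False
    then have lim: "osup (oset \<alpha>) = \<alpha>" using osup_le_bound[of "oset \<alpha>" \<alpha>] by auto
    show ?thesis
    proof (cases "\<alpha> = ozero")
      case True
      then show ?thesis using X lev_zero ozero_le leD by blast
    next
      case False
      obtain \<gamma> Z where \<gamma>: "\<gamma> \<in> C \<alpha>" "Z \<in> lev \<gamma> E" and XZ: "X = path lev (C \<alpha>) \<alpha> (\<gamma>, Z) E"
        using X lev_limit[OF lim False] by auto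
      have below: "\<delta> < \<alpha>" if "\<delta> \<in> C \<alpha>" for \<delta> using C_subset that by blast
      have "X = (\<Union>\<delta>\<in>{\<delta> \<in> C \<alpha>. \<gamma> \<le> \<delta> \<and> \<delta> < \<alpha>}. path lev (C \<alpha>) \<delta> (\<gamma>, Z) E)"
        using lim C_sup[of \<alpha>] C_subset[of \<alpha>] unfolding XZ
        by (intro path_acc below[OF \<gamma>(1)]) (simp add: inf.absorb1)
      moreover have "path lev (C \<alpha>) \<delta> (\<gamma>, Z) E \<subseteq> oset \<alpha>" if "\<delta> \<in> C \<alpha>" "\<gamma> \<le> \<delta>" for \<delta>
      proof -
        have "path lev (C \<alpha>) \<delta> (\<gamma>, Z) E \<subseteq> oset \<delta>"
          using path_in_lev[OF IH \<gamma> that] sub[OF below[OF that(1)]] by blast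
        also have "\<dots> \<subseteq> oset \<alpha>" using below[OF that(1)] by auto
        finally show ?thesis .
      qed
      ultimately have "X \<subseteq> oset \<alpha>" by blast
      moreover have "X \<inter> oset \<epsilon> \<in> lev \<epsilon> E" if \<epsilon>: "\<epsilon> < \<alpha>" for \<epsilon>
      proof -
        obtain \<delta> where \<delta>: "\<delta> \<in> C \<alpha>" "max \<epsilon> \<gamma> < \<delta>"
          \<comment> \<open>Only from the starting height \<gamma> on does the branch pass through
            the levels at ladder points, so \<epsilon> is reached by restricting from a ladder point
            above both.\<close>
          using C_unbounded[OF lim, of "max \<epsilon> \<gamma>"] \<epsilon> below[OF \<gamma>(1)] by auto
        then have "X \<inter> oset \<delta> \<in> lev \<delta> E"
          using path_limit[OF IH lim \<gamma> \<delta>(1)] path_in_lev[OF IH \<gamma> \<delta>(1)] XZ by auto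
        then have "X \<inter> oset \<delta> \<inter> oset \<epsilon> \<in> lev \<epsilon> E"
          using restr[OF below[OF \<delta>(1)], of _ \<epsilon>] \<delta>(2) by auto
        moreover have "X \<inter> oset \<delta> \<inter> oset \<epsilon> = X \<inter> oset \<epsilon>" using \<delta>(2) by auto
        ultimately show ?thesis by simp
      qed
      ultimately show ?thesis by blast
    qed
  qed
  then have restr': "X \<subseteq> oset \<alpha> \<and> (\<forall>\<gamma>\<le>\<alpha>. X \<inter> oset \<gamma> \<in> lev \<gamma> E)" if "X \<in> lev \<alpha> E" for X
    using that by (metis inf.absorb1 le_less)
  have "\<exists>Y\<in>lev \<alpha> E. Y \<inter> oset \<gamma> = X" if \<gamma>: "\<gamma> < \<alpha>" "X \<in> lev \<gamma> E" for \<gamma> X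
  proof (cases "osup (oset \<alpha>) < \<alpha>")
    case True
    then obtain b where b': "osup (oset \<alpha>) = b" "b < \<alpha>" by blast
    note b = b'(2) oset_successor[OF b']
    have "\<gamma> \<in> insert b (oset b)" using \<gamma>(1) unfolding b(2)[symmetric] by simp
    then have "\<gamma> \<le> b" by auto
    then obtain Y where "Y \<in> lev b E" "Y \<inter> oset \<gamma> = X" using ext[OF b(1) _ \<gamma>(2)] by blast
    then show ?thesis unfolding lev_successor[OF b'] by blast
  next
    case False
    then have lim: "osup (oset \<alpha>) = \<alpha>" using osup_le_bound[of "oset \<alpha>" \<alpha>] by auto
    have pos: "\<alpha> \<noteq> ozero" using \<gamma>(1) ozero_le leD by blast
    obtain \<delta> where \<delta>: "\<delta> \<in> C \<alpha>" "\<gamma> < \<delta>" using C_unbounded[OF lim \<gamma>(1)] by blast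
    have "\<delta> < \<alpha>" using \<delta> C_subset by blast
    then obtain Y where Y: "Y \<in> lev \<delta> E" "Y \<inter> oset \<gamma> = X"
      using ext[OF _ less_imp_le[OF \<delta>(2)] \<gamma>(2)] by blast
    \<comment> \<open>The branch that starts at \<open>Y\<close> itself is the required extension;
      this is why a limit level has a branch from every node on a ladder level.\<close>
    let ?Z = "path lev (C \<alpha>) \<alpha> (\<delta>, Y) E"
    have "?Z \<inter> oset \<delta> = Y"
      using path_limit[OF IH lim \<delta>(1) Y(1) \<delta>(1)] by (simp add: path_start)
    moreover have "?Z \<inter> oset \<delta> \<inter> oset \<gamma> = ?Z \<inter> oset \<gamma>" using \<delta>(2) by auto
    ultimately have "?Z \<inter> oset \<gamma> = X" using Y(2) by simp
    moreover have "?Z \<in> lev \<alpha> E" using lev_limit[OF lim pos] \<delta>(1) Y(1) by blast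
    ultimately show ?thesis by blast
  qed
  moreover have "\<exists>Y\<in>lev \<alpha> E. Y \<inter> oset \<alpha> = X" if "X \<in> lev \<alpha> E" for X
    using restr'[OF that] that by blast
  ultimately show ?case using restr' by (metis le_less)
qed

lemma coherent_below: "coherent_below \<alpha>"
  unfolding coherent_below_def by (intro allI impI) (rule lev_coherent)

lemma lev_subset: "X \<in> lev \<alpha> E \<Longrightarrow> X \<subseteq> oset \<alpha>"
  and lev_restrict: "X \<in> lev \<alpha> E \<Longrightarrow> \<gamma> \<le> \<alpha> \<Longrightarrow> X \<inter> oset \<gamma> \<in> lev \<gamma> E"
  and lev_extend: "X \<in> lev \<gamma> E \<Longrightarrow> \<gamma> \<le> \<alpha> \<Longrightarrow> \<exists>Y\<in>lev \<alpha> E. Y \<inter> oset \<gamma> = X"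
  using lev_coherent[of \<alpha> E] by simp_all

lemma lev_nonempty: "lev \<alpha> E \<noteq> {}"
  using lev_extend[of "{}" ozero E \<alpha>] lev_zero by auto

text \<open>A limit level has at most one node for each node of a ladder level, and the ladder is
  small.\<close>

lemma lev_small: "small (lev \<alpha> E)"
proof (induction \<alpha> rule: less_induct)
  case (less \<alpha>)
  consider b where "osup (oset \<alpha>) = b" "b < \<alpha>" | "\<alpha> = ozero" | "osup (oset \<alpha>) = \<alpha>" "\<alpha> \<noteq> ozero"
    using osup_le_bound[of "oset \<alpha>" \<alpha>] by fastforce
  then show ?case
  proof cases
    case 1
    then show ?thesis using less lev_successor[OF 1] by (auto intro!: small_Un small_image)
  next
    case 2
    then show ?thesis by (simp add: lev_zero small_finite)
  next
    case 3
    show ?thesis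
      unfolding lev_limit[OF 3] using less C_subset
      by (intro small_UN small_image small_subset[OF small_oset C_subset]) blast
  qed
qed

end

section \<open>Sealing dense open sets of products\<close>

context proxy_construction
begin

text \<open>Level \<alpha> of the product of the trees attached to the members of
  \<open>Bs\<close>.\<close>

definition prodlev :: "'a set list \<Rightarrow> 'a \<Rightarrow> 'a set list set" where
  "prodlev Bs \<alpha> = {zs. length zs = length Bs \<and> (\<forall>k < length Bs. zs ! k \<in> lev \<alpha> (Bs ! k))}"

lemma prodlev_small: "small (prodlev Bs \<alpha>)"
proof (rule small_subset)
  show "prodlev Bs \<alpha> \<subseteq> lists (\<Union>k\<in>{..<length Bs}. lev \<alpha> (Bs ! k))"
    unfolding prodlev_def by (fastforce simp: in_set_conv_nth)
  show "small (lists (\<Union>k\<in>{..<length Bs}. lev \<alpha> (Bs ! k)))"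
    by (intro small_lists small_UN lev_small) (simp add: small_finite)
qed

lemma prodlev_restrict:
  "zs \<in> prodlev Bs \<alpha> \<Longrightarrow> \<gamma> \<le> \<alpha> \<Longrightarrow> map (\<lambda>Z. Z \<inter> oset \<gamma>) zs \<in> prodlev Bs \<gamma>"
  unfolding prodlev_def by (auto intro: lev_restrict)

lemma prodlev_subset: "zs \<in> prodlev Bs \<alpha> \<Longrightarrow> Z \<in> set zs \<Longrightarrow> Z \<subseteq> oset \<alpha>"
  unfolding prodlev_def in_set_conv_nth using lev_subset by force

text \<open>Each of the finitely many pairs differs at some ordinal, and these ordinals have a
  common bound.\<close>

lemma ex_distinct_traces:
  assumes "distinct Bs"
  shows "\<exists>\<epsilon>::'a. \<forall>\<beta>>\<epsilon>. distinct (map (\<lambda>B. B \<inter> oset \<beta>) Bs)"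
proof -
  define d where "d = (\<lambda>(j, k). SOME \<xi>::'a. (\<xi> \<in> Bs ! j) \<noteq> (\<xi> \<in> Bs ! k))"
  have "small (d ` ({..<length Bs} \<times> {..<length Bs}))" by (simp add: small_finite)
  then obtain \<epsilon> where \<epsilon>: "\<forall>\<xi> \<in> d ` ({..<length Bs} \<times> {..<length Bs}). \<xi> < \<epsilon>"
    using small_bounded by blast
  have "Bs ! j \<inter> oset \<beta> \<noteq> Bs ! k \<inter> oset \<beta>"
    if "\<epsilon> < \<beta>" "j < length Bs" "k < length Bs" "j \<noteq> k" for \<beta> j k
  proof -
    have "Bs ! j \<noteq> Bs ! k" using assms that by (simp add: nth_eq_iff_index_eq)
    then have "\<exists>\<xi>. (\<xi> \<in> Bs ! j) \<noteq> (\<xi> \<in> Bs ! k)" by blast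
    then have "(d (j, k) \<in> Bs ! j) \<noteq> (d (j, k) \<in> Bs ! k)" unfolding d_def prod.case by (rule someI_ex)
    moreover have "d (j, k) < \<beta>"
    proof -
      have "d (j, k) < \<epsilon>" using \<epsilon> that by blast
      then show ?thesis using that(1) by (rule less_trans)
    qed
    ultimately show ?thesis by blast
  qed
  then have "\<forall>\<beta>>\<epsilon>. distinct (map (\<lambda>B. B \<inter> oset \<beta>) Bs)" by (auto simp: distinct_conv_nth)
  then show ?thesis by blast
qed

text \<open>Explains the use of \<open>n = 1\<close> in the proxy principle: the tail of the ladder
  from \<open>b\<close> has \<open>b\<close> as its first point, so the point right after
  \<open>b\<close> is its first successor.\<close>

lemma next_in_C:
  assumes lim: "osup (oset \<alpha>) = \<alpha>" and b: "b \<in> C \<alpha>"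
  obtains \<beta> where "\<beta> \<in> C \<alpha>" "b < \<beta>" "osup (C \<alpha> \<inter> oset \<beta>) = b" "\<beta> \<in> suc_n 1 (C \<alpha> - oset b)"
proof -
  have "b < \<alpha>" using b C_subset by blast
  define \<beta> where "\<beta> = (LEAST \<beta>. \<beta> \<in> C \<alpha> \<and> b < \<beta>)"
  obtain \<delta>0 where "\<delta>0 \<in> C \<alpha> \<and> b < \<delta>0" using C_unbounded[OF lim \<open>b < \<alpha>\<close>] by blast
  then have \<beta>: "\<beta> \<in> C \<alpha> \<and> b < \<beta>" unfolding \<beta>_def by (rule LeastI)
  have le: "\<delta> \<le> b" if "\<delta> \<in> C \<alpha>" "\<delta> < \<beta>" for \<delta>
    using not_less_Least[OF that(2)[unfolded \<beta>_def]] that(1) by (simp add: not_less)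
  have sup: "osup (C \<alpha> \<inter> oset \<beta>) = b"
    using osup_ge[of "C \<alpha> \<inter> oset \<beta>" \<beta> b] b \<beta> le by (intro order.antisym osup_least) auto
  have single: "(C \<alpha> - oset b) \<inter> oset \<beta> = {b}"
    using le b \<beta> by (auto simp: not_less intro: order.antisym)
  have "osup {b} = b"
    using osup_ge[of "{b}" \<beta> b] \<beta> by (intro order.antisym osup_least) auto
  then have "\<beta> \<notin> acc (C \<alpha> - oset b)"
    using \<beta> unfolding acc_def mem_Collect_eq single by (metis less_irrefl)
  moreover have "\<beta> \<in> C \<alpha> - oset b" using \<beta> by (simp add: not_less less_imp_le)
  ultimately have "\<beta> \<in> nacc (C \<alpha> - oset b)" unfolding nacc_def by blast
  then have "\<beta> \<in> suc_n 1 (C \<alpha> - oset b)" unfolding suc_n_def mem_Collect_eq single by simp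
  then show ?thesis using that \<beta> sup by blast
qed

text \<open>At \<beta> the guess is correct for the whole tuple, so all branches jump together onto
  one tuple that meets \<open>D\<close> no later than at height \<beta>. Openness carries membership
  up to \<alpha>, whatever the branches do after \<beta>.\<close>

lemma sealing_step:
  assumes lim: "osup (oset \<alpha>) = \<alpha>"
    and D_sub: "\<And>\<delta> zs. (\<delta>, zs) \<in> D \<Longrightarrow> zs \<in> prodlev Bs \<delta>"
    and D_open: "\<And>\<delta> \<delta>' zs. zs \<in> prodlev Bs \<delta>' \<Longrightarrow> \<delta> \<le> \<delta>' \<Longrightarrow>
      (\<delta>, map (\<lambda>Z. Z \<inter> oset \<delta>) zs) \<in> D \<Longrightarrow> (\<delta>', zs) \<in> D"
    and xs: "length xs = length Bs"
      "\<And>k. k < length Bs \<Longrightarrow> fst (xs ! k) \<in> C \<alpha> \<and> fst (xs ! k) \<le> b \<and> snd (xs ! k) \<in> lev (fst (xs ! k)) (Bs ! k)"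
    and b: "b \<in> C \<alpha>" "\<beta> \<in> C \<alpha>" "b < \<beta>" "osup (C \<alpha> \<inter> oset \<beta>) = b"
    and G: "G \<beta> = (map (\<lambda>B. B \<inter> oset \<beta>) Bs, xs, {(\<delta>, zs) \<in> D. \<delta> < \<beta>})"
    and distinct: "distinct (map (\<lambda>B. B \<inter> oset \<beta>) Bs)"
    and D_dense: "\<And>zs. zs \<in> prodlev Bs b \<Longrightarrow>
       \<exists>\<delta> zs'. b \<le> \<delta> \<and> \<delta> < \<beta> \<and> (\<delta>, zs') \<in> D \<and> map (\<lambda>Z. Z \<inter> oset b) zs' = zs"
    and zs: "length zs = length Bs"
      "\<And>k. k < length Bs \<Longrightarrow> zs ! k = path lev (C \<alpha>) \<alpha> (xs ! k) (Bs ! k)"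
      "zs \<in> prodlev Bs \<alpha>"
  shows "(\<alpha>, zs) \<in> D"
proof -
  let ?n = "length Bs" and ?P = "\<lambda>k \<beta>. path lev (C \<alpha>) \<beta> (xs ! k) (Bs ! k)"
  let ?D = "{(\<delta>, zs) \<in> D. \<delta> < \<beta>}" and ?Bs = "map (\<lambda>B. B \<inter> oset \<beta>) Bs"
  let ?hits = "hits (lev \<beta>) \<beta> b (path lev (C \<alpha>) b) ?Bs xs ?D"
  have P: "?P k \<delta> \<in> lev \<delta> (Bs ! k)" "?P k \<alpha> \<inter> oset \<delta> = ?P k \<delta>"
    if "k < ?n" "\<delta> \<in> C \<alpha>" "fst (xs ! k) \<le> \<delta>" for k \<delta>
    using path_in_lev[OF coherent_below, of "fst (xs ! k)" \<alpha> "snd (xs ! k)" "Bs ! k" \<delta>]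
      path_limit[OF coherent_below lim, of "fst (xs ! k)" "snd (xs ! k)" "Bs ! k" \<delta>] that xs(2)[OF that(1)]
    by simp_all
  have tr: "path lev (C \<alpha>) b x (E \<inter> oset \<beta>) = path lev (C \<alpha>) b x E" for x E
    by (rule path_trace) (use b(3) in auto)
  \<comment> \<open>The positions at \<open>b\<close> form a node of the product. Density yields an
    extension in \<open>D\<close> below \<beta>, and extending it further to level \<beta> produces
    a tuple witnessing \<open>hits\<close>.\<close>
  have "map (\<lambda>k. ?P k b) [0..<?n] \<in> prodlev Bs b"
    unfolding prodlev_def using P(1) b(1) xs(2) by simp
  then obtain \<delta> zs' where \<delta>: "b \<le> \<delta>" "\<delta> < \<beta>" "(\<delta>, zs') \<in> D"
    and zs': "map (\<lambda>Z. Z \<inter> oset b) zs' = map (\<lambda>k. ?P k b) [0..<?n]"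
    using D_dense by blast
  have len': "length zs' = ?n" and lev': "\<And>k. k < ?n \<Longrightarrow> zs' ! k \<in> lev \<delta> (Bs ! k)"
    using D_sub[OF \<delta>(3)] unfolding prodlev_def by auto
  have "\<forall>k<?n. \<exists>Y. Y \<in> lev \<beta> (Bs ! k) \<and> Y \<inter> oset \<delta> = zs' ! k"
    using lev_extend[OF lev' less_imp_le[OF \<delta>(2)]] by blast
  then obtain ys where ys: "length ys = ?n"
    "\<And>k. k < ?n \<Longrightarrow> ys ! k \<in> lev \<beta> (Bs ! k) \<and> ys ! k \<inter> oset \<delta> = zs' ! k"
    unfolding Skolem_list_nth by blast
  have ysb: "ys ! k \<inter> oset b = ?P k b" if k: "k < ?n" for k
  proof -
    have "ys ! k \<inter> oset b = ys ! k \<inter> oset \<delta> \<inter> oset b" using \<delta>(1) by auto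
    also have "\<dots> = map (\<lambda>Z. Z \<inter> oset b) zs' ! k" using ys(2)[OF k] k len' by simp
    finally show ?thesis unfolding zs' using k by simp
  qed
  have "map (\<lambda>Y. Y \<inter> oset \<delta>) ys = zs'"
    using ys len' by (intro nth_equalityI) auto
  then have "?hits ys"
    unfolding hits_def using ys ysb \<delta> lev_trace[of \<beta> \<beta>] tr less_imp_le[OF \<delta>(2)] by auto
  then have ex: "\<exists>ys. ?hits ys" by blast
  \<comment> \<open>This choice is the same term for every coordinate, so each branch moves to its
    own entry of one common tuple.\<close>
  define vs where "vs = (SOME ys. ?hits ys)"
  have vs: "?hits vs" unfolding vs_def using ex by (rule someI_ex)
  have P\<beta>: "?P k \<beta> = vs ! k" if k: "k < ?n" for k
  proof -
    have "fst (xs ! k) < \<beta>" using xs(2)[OF k] b(3) by (meson le_less_trans)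
    then have "?P k \<beta> = step (lev \<beta>) \<beta> b (path lev (C \<alpha>) b) (xs ! k) (Bs ! k)"
      using path_nacc[OF b(4), of "fst (xs ! k)" lev "snd (xs ! k)" "Bs ! k"] b(3) by auto
    also have "\<dots> = vs ! k"
      unfolding vs_def using k by (intro step_hit[OF G distinct ex]) auto
    finally show ?thesis .
  qed
  have "map (\<lambda>Z. Z \<inter> oset \<beta>) zs = vs"
  proof (rule nth_equalityI)
    show "length (map (\<lambda>Z. Z \<inter> oset \<beta>) zs) = length vs"
      using vs zs(1) unfolding hits_def by simp
    fix k assume "k < length (map (\<lambda>Z. Z \<inter> oset \<beta>) zs)"
    then have k: "k < ?n" using zs(1) by simp
    have "fst (xs ! k) \<le> \<beta>" using xs(2)[OF k] b(3) by (meson le_less_trans less_imp_le)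
    then show "map (\<lambda>Z. Z \<inter> oset \<beta>) zs ! k = vs ! k"
      using P(2)[OF k b(2)] P\<beta>[OF k] zs k by simp
  qed
  moreover obtain \<delta>' where \<delta>': "\<delta>' \<le> \<beta>" "(\<delta>', map (\<lambda>Y. Y \<inter> oset \<delta>') vs) \<in> D"
    using vs unfolding hits_def by auto
  moreover have "map (\<lambda>Y. Y \<inter> oset \<delta>') (map (\<lambda>Z. Z \<inter> oset \<beta>) zs) = map (\<lambda>Y. Y \<inter> oset \<delta>') zs"
  proof -
    have "oset \<beta> \<inter> oset \<delta>' = oset \<delta>'" using \<delta>'(1) by auto
    then show ?thesis by (simp add: Int_assoc)
  qed
  moreover have "\<delta>' \<le> \<alpha>"
  proof -
    have "\<beta> < \<alpha>" using b(2) C_subset by blast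
    then show ?thesis using \<delta>'(1) by (meson le_less_trans less_imp_le)
  qed
  ultimately show ?thesis using D_open[OF zs(3)] by simp
qed

text \<open>A node of the product at a limit level is determined by its tuple of starting nodes, and
  these tuples are coded by ordinals. The set \<open>B i\<close> holds the points with a correct
  guess for the tuple coded by \<open>i\<close>. The proxy principle provides an \<alpha> whose
  ladder meets all \<open>B i\<close> with \<open>i < \<alpha>\<close>, and closure of \<alpha>
  ensures that every tuple starting below \<alpha> has its code below \<alpha>.\<close>

lemma sealing:
  assumes "distinct Bs"
    and D_sub: "\<And>\<delta> zs. (\<delta>, zs) \<in> D \<Longrightarrow> zs \<in> prodlev Bs \<delta>"
    and D_open: "\<And>\<delta> \<delta>' zs. zs \<in> prodlev Bs \<delta>' \<Longrightarrow> \<delta> \<le> \<delta>' \<Longrightarrow>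
      (\<delta>, map (\<lambda>Z. Z \<inter> oset \<delta>) zs) \<in> D \<Longrightarrow> (\<delta>', zs) \<in> D"
    and D_dense: "\<And>\<delta> zs. zs \<in> prodlev Bs \<delta> \<Longrightarrow>
       \<exists>\<delta>' zs'. \<delta> \<le> \<delta>' \<and> (\<delta>', zs') \<in> D \<and> map (\<lambda>Z. Z \<inter> oset \<delta>) zs' = zs"
  obtains \<alpha> where "\<And>zs. zs \<in> prodlev Bs \<alpha> \<Longrightarrow> (\<alpha>, zs) \<in> D"
proof -
  let ?n = "length Bs"
  obtain \<epsilon> where \<epsilon>: "\<And>\<beta>::'a. \<epsilon> < \<beta> \<Longrightarrow> distinct (map (\<lambda>B. B \<inter> oset \<beta>) Bs)"
    using ex_distinct_traces[OF assms(1)] by blast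
  define ext where "ext \<delta> zs \<delta>' \<longleftrightarrow>
      \<delta> \<le> \<delta>' \<and> (\<exists>zs'. (\<delta>', zs') \<in> D \<and> map (\<lambda>Z. Z \<inter> oset \<delta>) zs' = zs)" for \<delta> zs \<delta>'
  \<comment> \<open>A height below which every node of level \<delta> of the product already has an
    extension in \<open>D\<close>; at a point closed under \<open>g\<close>, the guessed part of
    \<open>D\<close> is still dense below that point.\<close>
  define g where "g \<delta> = bound ((\<lambda>zs. SOME \<delta>'. ext \<delta> zs \<delta>') ` prodlev Bs \<delta>)" for \<delta>
  have g: "\<exists>\<delta>'. ext \<delta> zs \<delta>' \<and> \<delta>' < g \<delta>" if "zs \<in> prodlev Bs \<delta>" for \<delta> zs
  proof -
    have "\<exists>\<delta>'. ext \<delta> zs \<delta>'" using D_dense[OF that] unfolding ext_def by blast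
    then have "ext \<delta> zs (SOME \<delta>'. ext \<delta> zs \<delta>')" by (rule someI_ex)
    moreover have "(SOME \<delta>'. ext \<delta> zs \<delta>') < g \<delta>"
      unfolding g_def by (rule bound[OF small_image[OF prodlev_small]]) (use that in blast)
    ultimately show ?thesis by blast
  qed
  define Q where "Q \<eta> = {xs. length xs = ?n \<and>
      (\<forall>k < ?n. fst (xs ! k) \<le> \<eta> \<and> snd (xs ! k) \<in> lev (fst (xs ! k)) (Bs ! k))}" for \<eta>
  have Q_small: "small (Q \<eta>)" for \<eta>
  proof (rule small_subset)
    let ?X = "\<Union>\<gamma>\<in>{..\<eta>}. Pair \<gamma> ` (\<Union>k\<in>{..<?n}. lev \<gamma> (Bs ! k))"
    show "Q \<eta> \<subseteq> lists ?X"
    proof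
      fix xs assume xs: "xs \<in> Q \<eta>"
      have "x \<in> ?X" if x: "x \<in> set xs" for x
      proof -
        obtain k where "k < ?n" "x = xs ! k" using x xs unfolding Q_def in_set_conv_nth by auto
        then have "fst x \<le> \<eta>" "snd x \<in> lev (fst x) (Bs ! k)" "k < ?n" using xs unfolding Q_def by auto
        then show ?thesis by (cases x) auto
      qed
      then show "xs \<in> lists ?X" by blast
    qed
    show "small (lists ?X)"
      by (intro small_lists small_UN small_image small_atMost lev_small) (simp add: small_finite)
  qed
  obtain q :: "('a \<times> 'a set) list \<Rightarrow> 'a" where q: "inj_on q (\<Union>\<eta>. Q \<eta>)"
    using ex_inj_into_kappa[of Q, OF Q_small] by blast
  define good where "good xs \<beta> \<longleftrightarrow> \<epsilon> < \<beta> \<and> (\<forall>\<eta><\<beta>. g \<eta> < \<beta>) \<and>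
      G \<beta> = (map (\<lambda>B. B \<inter> oset \<beta>) Bs, xs, {(\<delta>, zs) \<in> D. \<delta> < \<beta>})" for xs \<beta>
  \<comment> \<open>An ordinal that codes no tuple imposes no condition, so every \<open>B i\<close>
    is unbounded.\<close>
  define B where "B i = {\<beta>. \<forall>xs\<in>(\<Union>\<eta>. Q \<eta>). q xs = i \<longrightarrow> good xs \<beta>}" for i
  have "unbounded (B i)" for i
    unfolding unbounded_def
  proof
    fix \<xi>
    show "\<exists>\<beta>\<in>B i. \<xi> \<le> \<beta>"
    proof (cases "\<exists>xs\<in>(\<Union>\<eta>. Q \<eta>). q xs = i")
      case True
      then obtain xs \<eta> where xs: "xs \<in> Q \<eta>" "q xs = i" by blast
      have "\<exists>\<beta>. max \<epsilon> \<xi> < \<beta> \<and> (\<forall>\<eta><\<beta>. g \<eta> < \<beta>) \<and>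
          G \<beta> = (map (\<lambda>B. B \<inter> oset \<beta>) Bs, xs, {(\<delta>, zs) \<in> D. \<delta> < \<beta>})"
      proof (rule guess)
        show "length xs = ?n" using xs unfolding Q_def by blast
        show "snd x \<subseteq> oset (fst x)" if "x \<in> set xs" for x
          using that xs(1) lev_subset unfolding Q_def in_set_conv_nth by auto
        show "Z \<subseteq> oset \<delta>" if "(\<delta>, zs) \<in> D" "Z \<in> set zs" for \<delta> zs Z
          using prodlev_subset[OF D_sub] that by blast
        show "small {zs. (\<delta>, zs) \<in> D}" for \<delta>
          by (rule small_subset[OF prodlev_small]) (use D_sub in blast)
      qed
      then obtain \<beta> where "\<xi> < \<beta>" "good xs \<beta>" unfolding good_def by auto
      moreover have "xs' = xs" if "xs' \<in> (\<Union>\<eta>. Q \<eta>)" "q xs' = i" for xs'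
      proof (rule inj_onD[OF q _ that(1)])
        show "q xs' = q xs" using that(2) xs(2) by simp
        show "xs \<in> (\<Union>\<eta>. Q \<eta>)" using xs(1) by blast
      qed
      ultimately have "\<beta> \<in> B i" unfolding B_def by blast
      then show ?thesis using \<open>\<xi> < \<beta>\<close> less_imp_le by blast
    next
      case False
      then have "\<xi> \<in> B i" unfolding B_def by blast
      then show ?thesis by blast
    qed
  qed
  then have stat: "stationary {\<alpha>. \<forall>i<\<alpha>. \<forall>n::nat.
      osup {\<beta> \<in> C \<alpha>. suc_n n (C \<alpha> - oset \<beta>) \<subseteq> B i} = \<alpha>}" (is "stationary ?S")
    by (rule C_hits)
  obtain \<alpha> where "\<alpha> \<in> ?S" and pos: "ozero < \<alpha>"
    and closed: "\<And>\<eta>. \<eta> < \<alpha> \<Longrightarrow> bound (q ` Q \<eta>) < \<alpha>"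
    by (rule stationary_closed_point[OF stat, of ozero "\<lambda>\<eta>. bound (q ` Q \<eta>)"]) blast
  then have hit: "osup {\<beta> \<in> C \<alpha>. suc_n 1 (C \<alpha> - oset \<beta>) \<subseteq> B i} = \<alpha>" if "i < \<alpha>" for i
    using that by blast
  \<comment> \<open>The hits lie below \<alpha> and have supremum \<alpha>, which excludes
    successors.\<close>
  have lim: "osup (oset \<alpha>) = \<alpha>"
  proof (rule order.antisym)
    show "osup (oset \<alpha>) \<le> \<alpha>" by (rule osup_le_bound) simp
    have "osup {\<beta> \<in> C \<alpha>. suc_n 1 (C \<alpha> - oset \<beta>) \<subseteq> B ozero} \<le> osup (oset \<alpha>)"
      using C_subset[of \<alpha>] osup_ge[of "oset \<alpha>" \<alpha>] by (intro osup_least) blast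
    then show "\<alpha> \<le> osup (oset \<alpha>)" using hit[OF pos] by simp
  qed
  show ?thesis
  proof (rule that[of \<alpha>])
    fix zs assume zs: "zs \<in> prodlev Bs \<alpha>"
    have "\<alpha> \<noteq> ozero" using pos by simp
    then have "\<forall>k<?n. \<exists>x. fst x \<in> C \<alpha> \<and> snd x \<in> lev (fst x) (Bs ! k) \<and>
        zs ! k = path lev (C \<alpha>) \<alpha> x (Bs ! k)"
      using zs unfolding prodlev_def lev_limit[OF lim \<open>\<alpha> \<noteq> ozero\<close>] by fastforce
    then obtain xs where xs: "length xs = ?n" "\<And>k. k < ?n \<Longrightarrow> fst (xs ! k) \<in> C \<alpha> \<and>
        snd (xs ! k) \<in> lev (fst (xs ! k)) (Bs ! k) \<and> zs ! k = path lev (C \<alpha>) \<alpha> (xs ! k) (Bs ! k)"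
      unfolding Skolem_list_nth by blast
    \<comment> \<open>Inserting \<open>ozero\<close> makes the maximum meaningful for the empty
      tuple as well.\<close>
    define \<eta> where "\<eta> = Max (insert ozero (fst ` set xs))"
    have "\<eta> \<in> insert ozero (fst ` set xs)" unfolding \<eta>_def by (intro Max_in) auto
    moreover have "fst x < \<alpha>" if "x \<in> set xs" for x
      using that xs C_subset unfolding in_set_conv_nth by auto
    ultimately have "\<eta> < \<alpha>" using pos by auto
    have \<eta>: "fst (xs ! k) \<le> \<eta>" if "k < ?n" for k
      unfolding \<eta>_def using that xs(1) by (intro Max_ge) auto
    have xsQ: "xs \<in> Q \<eta>" unfolding Q_def using xs \<eta> by blast
    have "q xs < bound (q ` Q \<eta>)" by (rule bound[OF small_image[OF Q_small]]) (use xsQ in blast)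
    then have "q xs < \<alpha>" using closed[OF \<open>\<eta> < \<alpha>\<close>] by (rule less_trans)
    then have "osup {\<beta> \<in> C \<alpha>. suc_n 1 (C \<alpha> - oset \<beta>) \<subseteq> B (q xs)} = \<alpha>" by (rule hit)
    moreover have "{\<beta> \<in> C \<alpha>. suc_n 1 (C \<alpha> - oset \<beta>) \<subseteq> B (q xs)} \<subseteq> oset \<alpha>"
      using C_subset by blast
    \<comment> \<open>Choosing \<open>b\<close> above \<eta> ensures that every branch of the tuple
      has started by the time it reaches \<open>b\<close>.\<close>
    ultimately obtain b where b: "b \<in> C \<alpha>" "suc_n 1 (C \<alpha> - oset b) \<subseteq> B (q xs)" "\<eta> < b"
      using less_osup[of _ \<alpha> \<eta>] \<open>\<eta> < \<alpha>\<close> by (metis (mono_tags, lifting) mem_Collect_eq)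
    obtain \<beta> where \<beta>: "\<beta> \<in> C \<alpha>" "b < \<beta>" "osup (C \<alpha> \<inter> oset \<beta>) = b" "\<beta> \<in> suc_n 1 (C \<alpha> - oset b)"
      using next_in_C[OF lim b(1)] by blast
    have "\<beta> \<in> B (q xs)" using b(2) \<beta>(4) by blast
    then have good: "good xs \<beta>" unfolding B_def using xsQ by blast
    show "(\<alpha>, zs) \<in> D"
    proof (rule sealing_step[OF lim D_sub D_open xs(1) _ b(1) \<beta>(1-3)])
      show "fst (xs ! k) \<in> C \<alpha> \<and> fst (xs ! k) \<le> b \<and> snd (xs ! k) \<in> lev (fst (xs ! k)) (Bs ! k)"
        if "k < ?n" for k
        using xs(2)[OF that] \<eta>[OF that] b(3) by (meson le_less_trans less_imp_le)
      show "G \<beta> = (map (\<lambda>B. B \<inter> oset \<beta>) Bs, xs, {(\<delta>, zs) \<in> D. \<delta> < \<beta>})"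
        using good unfolding good_def by blast
      show "distinct (map (\<lambda>B. B \<inter> oset \<beta>) Bs)" using good \<epsilon> unfolding good_def by blast
      show "\<exists>\<delta> zs'. b \<le> \<delta> \<and> \<delta> < \<beta> \<and> (\<delta>, zs') \<in> D \<and> map (\<lambda>Z. Z \<inter> oset b) zs' = vs"
        if vs: "vs \<in> prodlev Bs b" for vs
      proof -
        obtain \<delta> where "ext b vs \<delta>" "\<delta> < g b" using g[OF vs] by blast
        moreover have "g b < \<beta>" using good \<beta>(2) unfolding good_def by blast
        ultimately have "\<delta> < \<beta>" by (meson less_trans)
        then show ?thesis using \<open>ext b vs \<delta>\<close> unfolding ext_def by blast
      qed
      show "length zs = ?n" using zs unfolding prodlev_def by blast
      show "zs ! k = path lev (C \<alpha>) \<alpha> (xs ! k) (Bs ! k)" if "k < ?n" for k using xs(2)[OF that] by blast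
      show "zs \<in> prodlev Bs \<alpha>" by (rule zs)
    qed
  qed
qed

end

section \<open>Trees given by a height function\<close>

text \<open>Composing one isomorphism with the inverse of the other gives a strictly increasing map
  between initial segments, and such a map never falls below the identity.\<close>

lemma has_height_unique:
  fixes \<alpha> \<beta> :: "'a::wellorder"
  assumes "has_height T lt x \<alpha>" "has_height T lt x \<beta>"
  shows "\<alpha> = \<beta>"
proof -
  let ?P = "preds T lt x"
  have le: "\<alpha> \<le> \<beta>"
    if f: "bij_betw f ?P (oset \<alpha>)" "\<forall>y\<in>?P. \<forall>z\<in>?P. lt y z \<longleftrightarrow> f y < f z"
      and g: "bij_betw g ?P (oset \<beta>)" "\<forall>y\<in>?P. \<forall>z\<in>?P. lt y z \<longleftrightarrow> g y < g z" for f g and \<alpha> \<beta> :: 'a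
  proof (rule ccontr)
    assume "\<not> \<alpha> \<le> \<beta>"
    then have "\<beta> < \<alpha>" by simp
    define h where "h \<xi> = g (inv_into ?P f \<xi>)" for \<xi>
    have inv: "inv_into ?P f \<xi> \<in> ?P" "f (inv_into ?P f \<xi>) = \<xi>" if "\<xi> < \<alpha>" for \<xi>
      using f(1) that by (auto simp: bij_betw_def inv_into_into f_inv_into_f)
    have mono: "h \<eta> < h \<xi>" if "\<eta> < \<alpha>" "\<xi> < \<alpha>" "\<eta> < \<xi>" for \<eta> \<xi>
      unfolding h_def using f(2) g(2) inv that by metis
    have below: "h \<xi> < \<beta>" if "\<xi> < \<alpha>" for \<xi>
      unfolding h_def using g(1) inv(1)[OF that] by (auto simp: bij_betw_def)
    have "\<xi> \<le> h \<xi>" if "\<xi> < \<alpha>" for \<xi>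
      using that mono
    proof (induction \<xi> rule: less_induct)
      case (less \<xi>)
      show ?case
      proof (rule ccontr)
        assume "\<not> \<xi> \<le> h \<xi>"
        then have lt: "h \<xi> < \<xi>" by simp
        have "h \<xi> < \<alpha>" using lt less.prems(1) by (rule less_trans)
        then have "h (h \<xi>) < h \<xi>" "h \<xi> \<le> h (h \<xi>)" using lt less by auto
        then show False by simp
      qed
    qed
    then have "\<beta> \<le> h \<beta>" using \<open>\<beta> < \<alpha>\<close> by blast
    then show False using below[OF \<open>\<beta> < \<alpha>\<close>] by simp
  qed
  obtain f g where f: "bij_betw f ?P (oset \<alpha>)" "\<forall>y\<in>?P. \<forall>z\<in>?P. lt y z \<longleftrightarrow> f y < f z"
    and g: "bij_betw g ?P (oset \<beta>)" "\<forall>y\<in>?P. \<forall>z\<in>?P. lt y z \<longleftrightarrow> g y < g z"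
    using assms unfolding has_height_def by blast
  show ?thesis using le[OF f g] le[OF g f] by (rule order.antisym)
qed

text \<open>The isomorphism for \<open>x\<close> restricts to one for \<open>y\<close>, and its
  value at \<open>y\<close> is the height of \<open>y\<close>.\<close>

lemma has_height_pred:
  fixes \<alpha> :: "'a::wellorder"
  assumes tree: "is_tree T lt" and x: "x \<in> T" "y \<in> T" "lt y x" and h: "has_height T lt x \<alpha>"
  shows "\<exists>\<beta><\<alpha>. has_height T lt y \<beta>"
proof -
  obtain f where f: "bij_betw f (preds T lt x) (oset \<alpha>)"
    and iso: "\<And>u v. u \<in> preds T lt x \<Longrightarrow> v \<in> preds T lt x \<Longrightarrow> lt u v \<longleftrightarrow> f u < f v"
    using h unfolding has_height_def by blast
  have y: "y \<in> preds T lt x" using x unfolding preds_def by blast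
  have trans: "\<forall>x\<in>T. \<forall>y\<in>T. \<forall>z\<in>T. lt x y \<and> lt y z \<longrightarrow> lt x z"
    using tree unfolding is_tree_def by (elim conjE)
  have sub: "preds T lt y \<subseteq> preds T lt x"
    unfolding preds_def using trans x by blast
  have "f ` preds T lt y = oset (f y)"
  proof
    show "f ` preds T lt y \<subseteq> oset (f y)" using iso[OF _ y] sub unfolding preds_def by blast
    show "oset (f y) \<subseteq> f ` preds T lt y"
    proof
      fix \<xi> assume "\<xi> \<in> oset (f y)"
      moreover have "f y < \<alpha>" using f y unfolding bij_betw_def by blast
      ultimately have "\<xi> \<in> oset \<alpha>" "\<xi> < f y" by (auto intro: less_trans)
      then obtain u where u: "u \<in> preds T lt x" "\<xi> = f u" using f unfolding bij_betw_def by blast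
      then have "lt u y" using iso[OF u(1) y] \<open>\<xi> < f y\<close> by simp
      then show "\<xi> \<in> f ` preds T lt y" using u unfolding preds_def by blast
    qed
  qed
  moreover have "inj_on f (preds T lt y)"
    using bij_betw_imp_inj_on[OF f] sub by (rule inj_on_subset)
  ultimately have bij: "bij_betw f (preds T lt y) (oset (f y))" unfolding bij_betw_def by blast
  have "has_height T lt y (f y)"
    unfolding has_height_def by (intro exI[of _ f] conjI ballI bij iso subsetD[OF sub])
  moreover have "f y < \<alpha>" using f y unfolding bij_betw_def by blast
  ultimately show ?thesis by blast
qed

text \<open>A criterion that replaces isomorphisms by a given rank function: below each node every
  smaller rank is taken by exactly one node. Heights can then be read off from
  \<open>ht\<close>.\<close>

definition leveled :: "'n set \<Rightarrow> ('n \<Rightarrow> 'n \<Rightarrow> bool) \<Rightarrow> ('n \<Rightarrow> 'a::wellorder) \<Rightarrow> bool" where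
  "leveled T lt ht \<longleftrightarrow> (\<forall>x\<in>T. \<forall>y\<in>T. lt x y \<longrightarrow> ht x < ht y) \<and>
     (\<forall>x\<in>T. \<forall>y\<in>T. \<forall>z\<in>T. lt x y \<and> lt y z \<longrightarrow> lt x z) \<and>
     (\<forall>x\<in>T. \<forall>\<beta><ht x. \<exists>y\<in>T. lt y x \<and> ht y = \<beta>) \<and>
     (\<forall>x\<in>T. \<forall>y\<in>T. \<forall>z\<in>T. lt y x \<and> lt z x \<and> ht y = ht z \<longrightarrow> y = z)"

lemma leveled_less:
  assumes "leveled T lt ht"
  shows "x \<in> T \<Longrightarrow> y \<in> T \<Longrightarrow> lt x y \<Longrightarrow> ht x < ht y"
  using assms[unfolded leveled_def, THEN conjunct1] by blast

lemma leveled_trans: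
  assumes "leveled T lt ht"
  shows "x \<in> T \<Longrightarrow> y \<in> T \<Longrightarrow> z \<in> T \<Longrightarrow> lt x y \<Longrightarrow> lt y z \<Longrightarrow> lt x z"
  using assms[unfolded leveled_def, THEN conjunct2, THEN conjunct1] by blast

lemma leveled_pred:
  assumes "leveled T lt ht"
  shows "x \<in> T \<Longrightarrow> \<beta> < ht x \<Longrightarrow> \<exists>y\<in>T. lt y x \<and> ht y = \<beta>"
  using assms[unfolded leveled_def, THEN conjunct2, THEN conjunct2, THEN conjunct1] by blast

lemma leveled_unique:
  assumes "leveled T lt ht"
  shows "x \<in> T \<Longrightarrow> y \<in> T \<Longrightarrow> z \<in> T \<Longrightarrow> lt y x \<Longrightarrow> lt z x \<Longrightarrow> ht y = ht z \<Longrightarrow> y = z"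
  using assms[unfolded leveled_def, THEN conjunct2, THEN conjunct2, THEN conjunct2] by blast

lemma leveled_less_iff:
  assumes lv: "leveled T lt ht" and x: "x \<in> T" "y \<in> T" "z \<in> T" "lt y x" "lt z x"
  shows "lt y z \<longleftrightarrow> ht y < ht z"
proof
  assume "ht y < ht z"
  then obtain y' where y': "y' \<in> T" "lt y' z" "ht y' = ht y" using leveled_pred[OF lv x(3)] by blast
  then have "lt y' x" using leveled_trans[OF lv y'(1) x(3,1)] x by blast
  then have "y' = y" using leveled_unique[OF lv x(1) y'(1) x(2)] x y' by blast
  then show "lt y z" using y' by simp
qed (use leveled_less[OF lv] x in blast)

lemma leveled_is_tree:
  assumes lv: "leveled T lt ht"
  shows "is_tree T lt"
proof -
  have "\<exists>m\<in>S. \<forall>s\<in>S. \<not> lt s m" if S: "S \<subseteq> {y\<in>T. lt y x}" "S \<noteq> {}" for S x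
  proof -
    define \<mu> where "\<mu> = (LEAST \<mu>. \<mu> \<in> ht ` S)"
    have "\<mu> \<in> ht ` S" unfolding \<mu>_def using S(2) by (metis LeastI image_eqI ex_in_conv)
    then obtain m where m: "m \<in> S" "ht m = \<mu>" by blast
    have "\<not> lt s m" if "s \<in> S" for s
    proof
      assume "lt s m"
      then have "ht s < \<mu>" using leveled_less[OF lv, of s m] that m S by blast
      then show False using not_less_Least[of "ht s" "\<lambda>\<mu>. \<mu> \<in> ht ` S"] that unfolding \<mu>_def by blast
    qed
    then show ?thesis using m by blast
  qed
  moreover have "lt y z \<or> y = z \<or> lt z y" if x: "x \<in> T" "y \<in> T" "z \<in> T" "lt y x" "lt z x" for x y z
    using leveled_less_iff[OF lv x] leveled_less_iff[OF lv x(1,3,2,5,4)] leveled_unique[OF lv x]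
    by (meson linorder_cases)
  moreover have "\<not> lt x x" if "x \<in> T" for x using leveled_less[OF lv that that] by blast
  moreover note leveled_trans[OF lv]
  ultimately show ?thesis unfolding is_tree_def by meson
qed

lemma leveled_has_height:
  assumes lv: "leveled T lt ht" and x: "x \<in> T"
  shows "has_height T lt x \<alpha> \<longleftrightarrow> ht x = \<alpha>"
proof -
  have "bij_betw ht (preds T lt x) (oset (ht x))"
    unfolding bij_betw_def
  proof
    show "inj_on ht (preds T lt x)"
      unfolding inj_on_def preds_def using leveled_unique[OF lv x] by blast
    show "ht ` preds T lt x = oset (ht x)"
      using leveled_less[OF lv _ x] leveled_pred[OF lv x] unfolding preds_def by fast
  qed
  then have "has_height T lt x (ht x)"
    unfolding has_height_def preds_def using leveled_less_iff[OF lv x] by blast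
  then show ?thesis using has_height_unique[of T lt x "ht x" \<alpha>] by auto
qed

section \<open>Splitting trees without large antichains are Souslin\<close>

definition oneup :: "'a::wellorder \<Rightarrow> 'a" where
  "oneup \<alpha> = (LEAST \<beta>. \<alpha> < \<beta>)"

definition splitting :: "'n set \<Rightarrow> ('n \<Rightarrow> 'n \<Rightarrow> bool) \<Rightarrow> ('n \<Rightarrow> 'a::wellorder) \<Rightarrow> bool" where
  "splitting T lt ht \<longleftrightarrow> (\<forall>x\<in>T. \<exists>y\<in>T. \<exists>z\<in>T. y \<noteq> z \<and> lt x y \<and> lt x z \<and>
     ht y = oneup (ht x) \<and> ht z = oneup (ht x))"

context regular_cardinal
begin

lemma less_oneup: "\<alpha> < oneup (\<alpha>::'a)"
  unfolding oneup_def by (rule LeastI_ex[OF ex_greater])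

lemma oneup_le: "\<alpha> < \<beta> \<Longrightarrow> oneup \<alpha> \<le> (\<beta>::'a)"
  unfolding oneup_def by (rule Least_le)

lemma oneup_less_iff: "oneup \<alpha> < oneup \<beta> \<longleftrightarrow> \<alpha> < (\<beta>::'a)"
proof
  assume "\<alpha> < \<beta>"
  then show "oneup \<alpha> < oneup \<beta>" using oneup_le less_oneup by (metis le_less_trans)
next
  assume less: "oneup \<alpha> < oneup \<beta>"
  show "\<alpha> < \<beta>"
  proof (rule ccontr)
    assume "\<not> \<alpha> < \<beta>"
    then have "\<beta> < oneup \<alpha>" using less_oneup[of \<alpha>] by (meson not_less le_less_trans)
    then show False using oneup_le less by (meson leD)
  qed
qed

lemma oset_oneup: "oset (oneup \<alpha>) = insert (\<alpha>::'a) (oset \<alpha>)"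
proof -
  have "\<beta> < oneup \<alpha> \<longleftrightarrow> \<beta> \<le> \<alpha>" for \<beta>
    using less_oneup[of \<alpha>] oneup_le[of \<alpha> \<beta>] by (meson leD le_less_trans not_le)
  then show ?thesis by (auto simp: le_less)
qed

lemma osup_oneup: "osup (oset (oneup \<alpha>)) = (\<alpha>::'a)"
proof (rule order.antisym)
  show "osup (oset (oneup \<alpha>)) \<le> \<alpha>" unfolding oset_oneup by (rule osup_least) auto
  show "\<alpha> \<le> osup (oset (oneup \<alpha>))" using less_oneup by (intro osup_ge) auto
qed

lemma leveled_kappa_tree:
  assumes lv: "leveled T lt (ht :: 'n \<Rightarrow> 'a)"
    and ne: "\<And>\<alpha>. \<exists>x\<in>T. ht x = \<alpha>" and sm: "\<And>\<alpha>. small {x \<in> T. ht x = \<alpha>}"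
  shows "kappa_tree (t :: 'a itself) T lt"
proof -
  have "level T lt \<alpha> = {x \<in> T. ht x = \<alpha>}" for \<alpha>
    unfolding level_def using leveled_has_height[OF lv] by blast
  then have "level T lt \<alpha> \<noteq> {} \<and> small (level T lt \<alpha>)" for \<alpha> :: 'a
    using ne[of \<alpha>] sm[of \<alpha>] by auto
  moreover have "\<forall>x\<in>T. \<exists>\<alpha>::'a. has_height T lt x \<alpha>" using leveled_has_height[OF lv] by blast
  ultimately show ?thesis
    unfolding kappa_tree_def kappa_eq[symmetric] using leveled_is_tree[OF lv] by blast
qed

text \<open>At every level choose a successor of the branch node that leaves the branch. A node
  strictly below \<open>u \<beta>\<close> is on the branch, so the chosen nodes are pairwise
  incomparable, and there are kappa many of them.\<close>

lemma splitting_no_branch: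
  assumes lv: "leveled T lt (ht :: 'n \<Rightarrow> 'a)" and split: "splitting T lt ht"
    and ac: "\<And>A. antichain T lt A \<Longrightarrow> small A"
  shows "\<not> cofinal_branch (t :: 'a itself) T lt b"
proof
  assume "cofinal_branch t T lt b"
  then have b: "b \<subseteq> T" "\<And>x y. x \<in> b \<Longrightarrow> y \<in> b \<Longrightarrow> lt x y \<or> x = y \<or> lt y x"
    "\<And>x y. x \<in> b \<Longrightarrow> y \<in> T \<Longrightarrow> lt y x \<Longrightarrow> y \<in> b" "\<And>\<alpha>::'a. b \<inter> level T lt \<alpha> \<noteq> {}"
    unfolding cofinal_branch_def by blast+
  have "\<exists>u\<in>T. u \<notin> b \<and> ht u = oneup \<alpha> \<and> (\<exists>x\<in>b. ht x = \<alpha> \<and> lt x u)" for \<alpha>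
  proof -
    obtain x where x: "x \<in> b" "x \<in> T" "ht x = \<alpha>"
      using b(4)[of \<alpha>] leveled_has_height[OF lv] unfolding level_def by blast
    obtain y z where yz: "y \<in> T" "z \<in> T" "y \<noteq> z" "lt x y" "lt x z" "ht y = oneup \<alpha>" "ht z = oneup \<alpha>"
      using split x unfolding splitting_def by blast
    have "\<not> (y \<in> b \<and> z \<in> b)"
      using b(2)[of y z] leveled_less[OF lv yz(1,2)] leveled_less[OF lv yz(2,1)] yz by auto
    then show ?thesis using x yz by blast
  qed
  then obtain u where u: "\<And>\<alpha>. u \<alpha> \<in> T \<and> u \<alpha> \<notin> b \<and> ht (u \<alpha>) = oneup \<alpha> \<and> (\<exists>x\<in>b. ht x = \<alpha> \<and> lt x (u \<alpha>))"
    by metis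
  have "\<not> lt (u \<alpha>) (u \<beta>)" for \<alpha> \<beta>
  proof
    assume lt: "lt (u \<alpha>) (u \<beta>)"
    have "oneup \<alpha> < oneup \<beta>" using leveled_less[OF lv _ _ lt] u by metis
    then have le: "oneup \<alpha> \<le> \<beta>" unfolding oneup_less_iff by (rule oneup_le)
    obtain x where x: "x \<in> b" "ht x = \<beta>" "lt x (u \<beta>)" using u by blast
    have xT: "x \<in> T" using x b(1) by blast
    note ux = u[of \<alpha>] u[of \<beta>]
    have "u \<alpha> = x \<or> lt (u \<alpha>) x"
    proof (cases "oneup \<alpha> = \<beta>")
      case True
      then show ?thesis using leveled_unique[OF lv _ _ xT lt x(3)] ux x(2) by simp
    next
      case False
      then have "ht (u \<alpha>) < ht x" using le ux x(2) by simp
      then show ?thesis using leveled_less_iff[OF lv _ _ xT lt x(3)] ux by blast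
    qed
    then have "u \<alpha> \<in> b" using b(3)[OF x(1)] x(1) ux by blast
    then show False using ux by blast
  qed
  then have "antichain T lt (range u)" unfolding antichain_def using u by blast
  then have "small (range u)" by (rule ac)
  \<comment> \<open>Inverting the injective \<open>u\<close> maps its range onto all of kappa, which
    is not small.\<close>
  then have "small ((\<lambda>x. THE \<alpha>. u \<alpha> = x) ` range u)" by (rule small_image)
  moreover have "inj u"
  proof (rule injI)
    fix \<alpha> \<beta> assume "u \<alpha> = u \<beta>"
    then have "oneup \<alpha> = oneup \<beta>" using u by metis
    then show "\<alpha> = \<beta>" using oneup_less_iff by (metis less_irrefl linorder_cases)
  qed
  then have "(\<lambda>x. THE \<alpha>. u \<alpha> = x) ` range u = UNIV"
    unfolding image_image by (auto simp: inj_eq)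
  ultimately show False using not_small_UNIV by simp
qed

lemma souslinI:
  assumes lv: "leveled T lt (ht :: 'n \<Rightarrow> 'a)" and "splitting T lt ht"
    and "\<And>\<alpha>. \<exists>x\<in>T. ht x = \<alpha>" "\<And>\<alpha>. small {x \<in> T. ht x = \<alpha>}"
    and "\<And>A. antichain T lt A \<Longrightarrow> small A"
  shows "souslin (t :: 'a itself) T lt"
  unfolding souslin_def aronszajn_def kappa_eq[symmetric]
  using leveled_kappa_tree[OF lv] splitting_no_branch[OF lv] assms by blast

section \<open>Finite products of leveled trees\<close>

lemma prod_nodes_iff:
  assumes lv: "\<And>S. S \<in> set Ts \<Longrightarrow> leveled S lt (ht :: 'n \<Rightarrow> 'a)"
  shows "xs \<in> prod_nodes (t :: 'a itself) Ts lt \<longleftrightarrow> length xs = length Ts \<and>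
    (\<forall>j < length Ts. xs ! j \<in> Ts ! j) \<and> (\<exists>\<alpha>. \<forall>j < length Ts. ht (xs ! j) = \<alpha>)"
  unfolding prod_nodes_def mem_Collect_eq using leveled_has_height[OF lv] nth_mem by metis

text \<open>All coordinates of a node have the same height, so the first one can represent it;
  nonemptiness provides that coordinate.\<close>

lemma leveled_prod:
  assumes lv: "\<And>S. S \<in> set Ts \<Longrightarrow> leveled S lt (ht :: 'n \<Rightarrow> 'a)" and ne: "Ts \<noteq> []"
  shows "leveled (prod_nodes (t :: 'a itself) Ts lt) (prod_lt lt) (\<lambda>xs. ht (xs ! 0))"
proof -
  let ?P = "prod_nodes t Ts lt" and ?n = "length Ts"
  have n: "0 < ?n" using ne by simp
  have lvj: "leveled (Ts ! j) lt ht" if "j < ?n" for j using lv that by simp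
  have P: "xs \<in> ?P \<longleftrightarrow> length xs = ?n \<and> (\<forall>j < ?n. xs ! j \<in> Ts ! j \<and> ht (xs ! j) = ht (xs ! 0))" for xs
    using prod_nodes_iff[OF lv, of Ts xs] n by metis
  have mem: "xs ! j \<in> Ts ! j" if "xs \<in> ?P" "j < ?n" for xs j
    using that unfolding P by simp
  have ltj: "lt (xs ! j) (ys ! j)" if "prod_lt lt xs ys" "xs \<in> ?P" "j < ?n" for xs ys j
    using that unfolding P prod_lt_def by simp
  have "\<exists>ys\<in>?P. prod_lt lt ys xs \<and> ht (ys ! 0) = \<beta>" if xs: "xs \<in> ?P" and \<beta>: "\<beta> < ht (xs ! 0)" for xs \<beta>
  proof -
    have "\<forall>j<?n. \<exists>y. y \<in> Ts ! j \<and> lt y (xs ! j) \<and> ht y = \<beta>"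
      using leveled_pred[OF lvj] xs \<beta> unfolding P by metis
    then obtain ys where ys: "length ys = ?n" "\<And>j. j < ?n \<Longrightarrow> ys ! j \<in> Ts ! j \<and> lt (ys ! j) (xs ! j) \<and> ht (ys ! j) = \<beta>"
      unfolding Skolem_list_nth by blast
    have "ys \<in> ?P \<and> prod_lt lt ys xs \<and> ht (ys ! 0) = \<beta>"
      using ys n xs unfolding P prod_lt_def by simp
    then show ?thesis by blast
  qed
  moreover have "ys = zs" if xs: "xs \<in> ?P" and ys: "ys \<in> ?P" and zs: "zs \<in> ?P"
    and lt: "prod_lt lt ys xs" "prod_lt lt zs xs" and ht: "ht (ys ! 0) = ht (zs ! 0)" for xs ys zs
  proof (rule nth_equalityI)
    show "length ys = length zs" using ys zs unfolding P by simp
    fix j assume "j < length ys"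
    then have j: "j < ?n" using ys unfolding P by simp
    have "xs ! j \<in> Ts ! j" "ys ! j \<in> Ts ! j" "zs ! j \<in> Ts ! j" "lt (ys ! j) (xs ! j)"
      "lt (zs ! j) (xs ! j)" "ht (ys ! j) = ht (zs ! j)"
      using xs ys zs lt ht j unfolding P prod_lt_def by simp_all
    then show "ys ! j = zs ! j" by (rule leveled_unique[OF lvj[OF j]])
  qed
  moreover have "ht (xs ! 0) < ht (ys ! 0)" if "xs \<in> ?P" "ys \<in> ?P" "prod_lt lt xs ys" for xs ys
  proof -
    show ?thesis
      by (rule leveled_less[OF lvj[OF n] mem[OF that(1) n] mem[OF that(2) n] ltj[OF that(3,1) n]])
  qed
  moreover have "prod_lt lt xs zs"
    if xyz: "xs \<in> ?P" "ys \<in> ?P" "zs \<in> ?P" "prod_lt lt xs ys" "prod_lt lt ys zs" for xs ys zs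
  proof -
    have "lt (xs ! j) (zs ! j)" if j: "j < ?n" for j
      by (rule leveled_trans[OF lvj[OF j] mem[OF xyz(1) j] mem[OF xyz(2) j] mem[OF xyz(3) j]
            ltj[OF xyz(4,1) j] ltj[OF xyz(5,2) j]])
    moreover have "length xs = ?n" "length zs = ?n" using xyz(1,3) unfolding P by simp_all
    ultimately show ?thesis unfolding prod_lt_def by simp
  qed
  ultimately show ?thesis unfolding leveled_def by blast
qed

lemma splitting_prod:
  assumes lv: "\<And>S. S \<in> set Ts \<Longrightarrow> leveled S lt (ht :: 'n \<Rightarrow> 'a)" and ne: "Ts \<noteq> []"
    and split: "\<And>S. S \<in> set Ts \<Longrightarrow> splitting S lt ht"
  shows "splitting (prod_nodes (t :: 'a itself) Ts lt) (prod_lt lt) (\<lambda>xs. ht (xs ! 0))"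
  unfolding splitting_def
proof
  let ?P = "prod_nodes t Ts lt" and ?n = "length Ts"
  fix xs assume xs: "xs \<in> ?P"
  have n: "0 < ?n" using ne by simp
  obtain \<alpha> where x: "length xs = ?n" "\<And>j. j < ?n \<Longrightarrow> xs ! j \<in> Ts ! j" "\<And>j. j < ?n \<Longrightarrow> ht (xs ! j) = \<alpha>"
    using xs prod_nodes_iff[OF lv] by metis
  have "\<forall>j<?n. \<exists>p. fst p \<in> Ts ! j \<and> snd p \<in> Ts ! j \<and> fst p \<noteq> snd p \<and> lt (xs ! j) (fst p) \<and>
      lt (xs ! j) (snd p) \<and> ht (fst p) = oneup \<alpha> \<and> ht (snd p) = oneup \<alpha>"
    using split[OF nth_mem] x unfolding splitting_def by (metis fst_conv snd_conv)
  then obtain ps where ps: "length ps = ?n" "\<And>j. j < ?n \<Longrightarrow> fst (ps ! j) \<in> Ts ! j \<and> snd (ps ! j) \<in> Ts ! j \<and>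
      fst (ps ! j) \<noteq> snd (ps ! j) \<and> lt (xs ! j) (fst (ps ! j)) \<and>
      lt (xs ! j) (snd (ps ! j)) \<and> ht (fst (ps ! j)) = oneup \<alpha> \<and> ht (snd (ps ! j)) = oneup \<alpha>"
    unfolding Skolem_list_nth by blast
  \<comment> \<open>The two successors of the tuple take the first, respectively the second, of the
    chosen successors in every coordinate.\<close>
  have "map f ps \<in> ?P" if "f = fst \<or> f = snd" for f
    using that prod_nodes_iff[OF lv, of Ts "map f ps"] ps by auto
  moreover have "map fst ps ! 0 \<noteq> map snd ps ! 0" using ps n by simp
  moreover have "prod_lt lt xs (map fst ps)" "prod_lt lt xs (map snd ps)"
    unfolding prod_lt_def using ps x(1) by auto
  moreover have "ht (map fst ps ! 0) = oneup (ht (xs ! 0))" "ht (map snd ps ! 0) = oneup (ht (xs ! 0))"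
    using ps n x(3)[OF n] by auto
  ultimately show "\<exists>ys\<in>?P. \<exists>zs\<in>?P. ys \<noteq> zs \<and> prod_lt lt xs ys \<and> prod_lt lt xs zs \<and>
     ht (ys ! 0) = oneup (ht (xs ! 0)) \<and> ht (zs ! 0) = oneup (ht (xs ! 0))"
    by metis
qed

end

section \<open>Kurepa families and the family of Souslin trees\<close>

text \<open>Numbering the nodes by ordinals turns branches into sets of ordinals. A trace on
  \<alpha> concerns a small set of nodes, whose heights are bounded by some \<gamma>, so the node of
  the branch at level \<gamma> decides it. Hence there are no more traces than nodes on that
  level.\<close>

lemma (in regular_cardinal) kurepa_family:
  assumes kurepa: "kurepa (t :: 'a itself) (K :: 'n set) lt"
  obtains F :: "'a set set" where "ordLess2 \<kappa> (card_of F)"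
    and "\<And>\<alpha>. small ((\<lambda>B. B \<inter> oset \<alpha>) ` F)"
    and "\<And>B. (\<And>\<alpha>. B \<inter> oset \<alpha> \<in> (\<lambda>B. B \<inter> oset \<alpha>) ` F) \<Longrightarrow> B \<in> F"
proof -
  have tree: "is_tree K lt" and hts: "\<forall>x\<in>K. \<exists>\<alpha>::'a. has_height K lt x \<alpha>"
    and lev_small: "\<And>\<alpha>::'a. small (level K lt \<alpha>)"
    and many: "ordLess2 \<kappa> (card_of {b. cofinal_branch t K lt b})" (is "ordLess2 \<kappa> (card_of ?Br)")
    using kurepa unfolding kurepa_def kappa_tree_def kappa_eq by blast+
  obtain e :: "'n \<Rightarrow> 'a" where e: "inj_on e (\<Union>\<alpha>. level K lt (\<alpha>::'a))"
    using ex_inj_into_kappa[of "\<lambda>\<alpha>::'a. level K lt \<alpha>", OF lev_small] by blast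
  have "(\<Union>\<alpha>. level K lt (\<alpha>::'a)) = K" using hts unfolding level_def by blast
  then have e: "inj_on e K" using e by simp
  have br: "b \<subseteq> K" if "b \<in> ?Br" for b using that unfolding cofinal_branch_def by blast
  define F0 where "F0 = (\<lambda>b. e ` b) ` ?Br"
  have "inj_on (\<lambda>b. e ` b) ?Br"
  proof (rule inj_onI)
    fix b c assume bc: "b \<in> ?Br" "c \<in> ?Br" "e ` b = e ` c"
    show "b = c" using inj_on_image_eq_iff[OF e br[OF bc(1)] br[OF bc(2)]] bc(3) by simp
  qed
  then have "ordLeq3 (card_of ?Br) (card_of F0)"
    unfolding F0_def using card_of_ordLeq by blast
  then have F0_many: "ordLess2 \<kappa> (card_of F0)" using many ordLess_ordLeq_trans by blast
  have F0_small: "small ((\<lambda>B. B \<inter> oset \<alpha>) ` F0)" for \<alpha>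
  proof -
    define h where "h x = (SOME \<beta>::'a. has_height K lt x \<beta>)" for x
    have h: "has_height K lt x (h x)" if "x \<in> K" for x
      unfolding h_def by (rule someI_ex[OF bspec[OF hts that]])
    define H where "H = {x \<in> K. e x < \<alpha>}"
    have "small (e ` H)" by (rule small_subset[OF small_oset[of \<alpha>]]) (auto simp: H_def)
    then have "small (inv_into K e ` e ` H)" by (rule small_image)
    moreover have "inv_into K e ` e ` H = H"
      by (rule inv_into_image_cancel[OF e]) (auto simp: H_def)
    ultimately have H: "small H" by simp
    define \<gamma> where "\<gamma> = bound (h ` H)"
    have below: "h x < \<gamma>" if "x \<in> H" for x
      unfolding \<gamma>_def by (rule bound[OF small_image[OF H]]) (use that in blast)
    have "e ` b \<inter> oset \<alpha> \<in> (\<lambda>x. e ` {y \<in> H. lt y x}) ` level K lt \<gamma>" if "b \<in> ?Br" for b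
    proof -
      have comp: "\<And>x y. x \<in> b \<Longrightarrow> y \<in> b \<Longrightarrow> lt x y \<or> x = y \<or> lt y x"
        and down: "\<And>x y. x \<in> b \<Longrightarrow> y \<in> K \<Longrightarrow> lt y x \<Longrightarrow> y \<in> b"
        and lev: "b \<inter> level K lt \<gamma> \<noteq> {}"
        using that unfolding cofinal_branch_def by blast+
      obtain x where x: "x \<in> b" "x \<in> K" "has_height K lt x \<gamma>" using lev unfolding level_def by blast
      have "lt y x" if y: "y \<in> b" "y \<in> H" for y
      proof -
        have yK: "y \<in> K" using y(2) unfolding H_def by blast
        have "y \<noteq> x"
        proof
          assume "y = x"
          then have "h y = \<gamma>" using has_height_unique[OF h[OF yK]] x(3) by blast
          then show False using below[OF y(2)] by simp
        qed
        moreover have "\<not> lt x y"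
        proof
          assume "lt x y"
          then obtain \<beta> where "\<beta> < h y" "has_height K lt x \<beta>"
            using has_height_pred[OF tree yK x(2) _ h[OF yK]] by blast
          moreover from this(2) have "\<beta> = \<gamma>" using x(3) by (rule has_height_unique)
          ultimately show False using below[OF y(2)] by simp
        qed
        ultimately show ?thesis using comp[OF x(1) y(1)] by blast
      qed
      moreover have "b \<subseteq> K" using br that by blast
      ultimately have "{y \<in> b. e y < \<alpha>} = {y \<in> H. lt y x}"
        using down[OF x(1)] unfolding H_def by blast
      moreover have "e ` b \<inter> oset \<alpha> = e ` {y \<in> b. e y < \<alpha>}" by blast
      ultimately have "e ` b \<inter> oset \<alpha> = e ` {y \<in> H. lt y x}" by simp
      moreover have "x \<in> level K lt \<gamma>" using x unfolding level_def by blast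
      ultimately show ?thesis by blast
    qed
    then have "(\<lambda>B. B \<inter> oset \<alpha>) ` F0 \<subseteq> (\<lambda>x. e ` {y \<in> H. lt y x}) ` level K lt \<gamma>"
      unfolding F0_def by blast
    then show ?thesis by (rule small_subset[OF small_image[OF lev_small]])
  qed
  \<comment> \<open>This closure adds new sets but no new traces, so the traces remain few while the
    family becomes closed under limits of traces.\<close>
  define F where "F = {B. \<forall>\<alpha>. B \<inter> oset \<alpha> \<in> (\<lambda>B. B \<inter> oset \<alpha>) ` F0}"
  have F0F: "F0 \<subseteq> F" unfolding F_def by blast
  have traces: "(\<lambda>B. B \<inter> oset \<alpha>) ` F \<subseteq> (\<lambda>B. B \<inter> oset \<alpha>) ` F0" for \<alpha> unfolding F_def by blast
  show ?thesis
  proof (rule that[of F])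
    show "ordLess2 \<kappa> (card_of F)" by (rule ordLess_ordLeq_trans[OF F0_many card_of_mono1[OF F0F]])
    show "small ((\<lambda>B. B \<inter> oset \<alpha>) ` F)" for \<alpha> using F0_small traces by (rule small_subset)
    show "B \<in> F" if "\<And>\<alpha>. B \<inter> oset \<alpha> \<in> (\<lambda>B. B \<inter> oset \<alpha>) ` F" for B
    proof -
      have "B \<inter> oset \<alpha> \<in> (\<lambda>B. B \<inter> oset \<alpha>) ` F0" for \<alpha> using subsetD[OF traces that] .
      then show ?thesis unfolding F_def by blast
    qed
  qed
qed

text \<open>The Kurepa family may be larger than kappa^+, whereas exactly kappa^+ subtrees are to be
  exhibited.\<close>

lemma (in regular_cardinal) ex_subset_cardSuc:
  assumes "ordLess2 \<kappa> (card_of F)"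
  obtains F' where "F' \<subseteq> F" "ordIso2 (card_of F') (cardSuc \<kappa>)"
proof -
  let ?Z = "Field (cardSuc \<kappa>)"
  have Z: "ordIso2 (card_of ?Z) (cardSuc \<kappa>)"
    by (rule card_of_Field_ordIso[OF cardSuc_Card_order[OF Card_order_kappa]])
  have "ordLeq3 (cardSuc \<kappa>) (card_of F)"
    using assms cardSuc_ordLess_ordLeq[OF Card_order_kappa card_of_Card_order] by blast
  then have "ordLeq3 (card_of ?Z) (card_of F)" using Z ordIso_ordLeq_trans by blast
  then obtain f where f: "inj_on f ?Z" "f ` ?Z \<subseteq> F" unfolding card_of_ordLeq[symmetric] by blast
  have "bij_betw f ?Z (f ` ?Z)" using f(1) by (rule inj_on_imp_bij_betw)
  then have "ordIso2 (card_of ?Z) (card_of (f ` ?Z))" using card_of_ordIso by blast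
  then have "ordIso2 (card_of (f ` ?Z)) (cardSuc \<kappa>)"
    using Z ordIso_symmetric ordIso_transitive by blast
  then show ?thesis using that f(2) by blast
qed

context proxy_construction
begin

lemma map_trace_trace:
  "\<gamma> \<le> \<delta> \<Longrightarrow> map (\<lambda>Z. Z \<inter> oset \<gamma>) (map (\<lambda>Z. Z \<inter> oset (\<delta>::'a)) zs) = map (\<lambda>Z. Z \<inter> oset \<gamma>) zs"
proof -
  assume "\<gamma> \<le> \<delta>"
  then have "oset \<delta> \<inter> oset \<gamma> = oset \<gamma>" by auto
  then show ?thesis by (simp add: Int_assoc)
qed

lemma map_trace_self: "zs \<in> prodlev Bs \<delta> \<Longrightarrow> map (\<lambda>Z. Z \<inter> oset \<delta>) zs = zs"
  by (intro map_idI inf.absorb1) (rule prodlev_subset)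

text \<open>The tuples that extend an element of \<open>R\<close>, together with those that no
  element of \<open>R\<close> extends, form a dense open set. If level \<alpha> lies inside it, an
  element of \<open>R\<close> above \<alpha> restricts to a tuple of the first kind, and so it
  properly extends another element of \<open>R\<close>.\<close>

lemma prodlev_antichain_bounded:
  assumes "distinct Bs"
    and R: "\<And>\<gamma> ws. (\<gamma>, ws) \<in> R \<Longrightarrow> ws \<in> prodlev Bs \<gamma>"
    and anti: "\<And>\<gamma> ws \<gamma>' ws'. (\<gamma>, ws) \<in> R \<Longrightarrow> (\<gamma>', ws') \<in> R \<Longrightarrow> \<gamma> < \<gamma>' \<Longrightarrow>
      map (\<lambda>Z. Z \<inter> oset \<gamma>) ws' \<noteq> ws"
  obtains \<alpha> where "\<And>\<gamma> ws. (\<gamma>, ws) \<in> R \<Longrightarrow> \<gamma> \<le> \<alpha>"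
proof -
  let ?r = "\<lambda>\<delta>. map (\<lambda>Z. Z \<inter> oset \<delta>)"
  define above where "above \<delta> zs \<longleftrightarrow> (\<exists>\<gamma> ws. (\<gamma>, ws) \<in> R \<and> \<gamma> \<le> \<delta> \<and> ?r \<gamma> zs = ws)" for \<delta> zs
  define below where "below \<delta> zs \<longleftrightarrow> (\<exists>\<gamma> ws. (\<gamma>, ws) \<in> R \<and> \<delta> \<le> \<gamma> \<and> ?r \<delta> ws = zs)" for \<delta> zs
  define D where "D = {(\<delta>, zs). zs \<in> prodlev Bs \<delta> \<and> (above \<delta> zs \<or> \<not> below \<delta> zs)}"
  obtain \<alpha> where \<alpha>: "\<And>zs. zs \<in> prodlev Bs \<alpha> \<Longrightarrow> (\<alpha>, zs) \<in> D"
  proof (rule sealing[OF assms(1), of D])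
    show "zs \<in> prodlev Bs \<delta>" if "(\<delta>, zs) \<in> D" for \<delta> zs using that unfolding D_def by blast
    show "(\<delta>', zs) \<in> D" if zs: "zs \<in> prodlev Bs \<delta>'" "\<delta> \<le> \<delta>'" "(\<delta>, ?r \<delta> zs) \<in> D" for \<delta> \<delta>' zs
    proof -
      have "above \<delta>' zs" if "above \<delta> (?r \<delta> zs)"
      proof -
        obtain \<gamma> ws where "(\<gamma>, ws) \<in> R" "\<gamma> \<le> \<delta>" "?r \<gamma> (?r \<delta> zs) = ws"
          using \<open>above \<delta> (?r \<delta> zs)\<close> unfolding above_def by blast
        then have "(\<gamma>, ws) \<in> R \<and> \<gamma> \<le> \<delta>' \<and> ?r \<gamma> zs = ws"
          using map_trace_trace[of \<gamma> \<delta> zs] order_trans[OF _ zs(2)] by simp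
        then show ?thesis unfolding above_def by blast
      qed
      moreover have "below \<delta> (?r \<delta> zs)" if "below \<delta>' zs"
      proof -
        obtain \<gamma> ws where "(\<gamma>, ws) \<in> R" "\<delta>' \<le> \<gamma>" "?r \<delta>' ws = zs"
          using \<open>below \<delta>' zs\<close> unfolding below_def by blast
        then have "(\<gamma>, ws) \<in> R \<and> \<delta> \<le> \<gamma> \<and> ?r \<delta> ws = ?r \<delta> zs"
          using map_trace_trace[OF zs(2), of ws] order_trans[OF zs(2)] by simp
        then show ?thesis unfolding below_def by blast
      qed
      ultimately show ?thesis using zs(1,3) unfolding D_def by blast
    qed
    \<comment> \<open>Density: a tuple extended by an element of \<open>R\<close> moves up to that
      element; any other tuple is already in \<open>D\<close>.\<close>
    show "\<exists>\<delta>' zs'. \<delta> \<le> \<delta>' \<and> (\<delta>', zs') \<in> D \<and> ?r \<delta> zs' = zs" if zs: "zs \<in> prodlev Bs \<delta>" for \<delta> zs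
    proof (cases "below \<delta> zs")
      case True
      then obtain \<gamma> ws where w: "(\<gamma>, ws) \<in> R" "\<delta> \<le> \<gamma>" "?r \<delta> ws = zs" unfolding below_def by blast
      have "above \<gamma> ws" unfolding above_def using w(1) map_trace_self[OF R[OF w(1)]] by blast
      then have "(\<gamma>, ws) \<in> D" unfolding D_def using R[OF w(1)] by blast
      then show ?thesis using w by blast
    next
      case False
      then have "(\<delta>, zs) \<in> D" unfolding D_def using zs by blast
      then show ?thesis using map_trace_self[OF zs] order_refl by blast
    qed
  qed blast
  show ?thesis
  proof (rule that[of \<alpha>], rule ccontr)
    fix \<gamma> ws assume w: "(\<gamma>, ws) \<in> R" and "\<not> \<gamma> \<le> \<alpha>"
    then have less: "\<alpha> < \<gamma>" by simp
    have "(\<alpha>, ?r \<alpha> ws) \<in> D" using prodlev_restrict[OF R[OF w] less_imp_le[OF less]] by (rule \<alpha>)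
    moreover have "below \<alpha> (?r \<alpha> ws)" unfolding below_def using w less_imp_le[OF less] by blast
    ultimately have "above \<alpha> (?r \<alpha> ws)" unfolding D_def by blast
    then obtain \<gamma>' ws' where w': "(\<gamma>', ws') \<in> R" "\<gamma>' \<le> \<alpha>" "?r \<gamma>' (?r \<alpha> ws) = ws'"
      unfolding above_def by blast
    have "\<gamma>' < \<gamma>" using w'(2) less by (rule le_less_trans)
    then show False using anti[OF w'(1) w] w'(3) map_trace_trace[OF w'(2), of ws] by simp
  qed
qed

end

section \<open>The common tree and its Souslin subtrees\<close>

locale kurepa_construction = proxy_construction +
  fixes F :: "'a set set"
  assumes F_small: "\<And>\<alpha>. small ((\<lambda>B. B \<inter> oset \<alpha>) ` F)"
    and F_closed: "\<And>B. (\<And>\<alpha>. B \<inter> oset \<alpha> \<in> (\<lambda>B. B \<inter> oset \<alpha>) ` F) \<Longrightarrow> B \<in> F"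
begin

text \<open>Members of \<open>F\<close> with the same trace on \<alpha> contribute the same nodes at
  height \<alpha>, by \<open>lev_cong\<close>; this keeps the levels of the union small although
  \<open>F\<close> is large.\<close>

definition subnodes :: "'a set \<Rightarrow> ('a \<times> 'a set \<times> 'a set) set" where
  "subnodes B = {(\<alpha>, B \<inter> oset \<alpha>, X) |\<alpha> X. X \<in> lev \<alpha> B}"

definition nodes :: "('a \<times> 'a set \<times> 'a set) set" where
  "nodes = (\<Union>B\<in>F. subnodes B)"

definition node_lt :: "'a \<times> 'a set \<times> 'a set \<Rightarrow> 'a \<times> 'a set \<times> 'a set \<Rightarrow> bool" where
  "node_lt = (\<lambda>(\<alpha>, E, X) (\<alpha>', E', X'). \<alpha> < \<alpha>' \<and> E = E' \<inter> oset \<alpha> \<and> X = X' \<inter> oset \<alpha>)"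

text \<open>The common tree is to consist of elements of \<open>'a\<close>, so its nodes are
  renamed; an injection exists because there are kappa many levels, each of them small.\<close>

definition code :: "'a \<times> 'a set \<times> 'a set \<Rightarrow> 'a" where
  "code = (SOME e. inj_on e nodes)"

definition decode :: "'a \<Rightarrow> 'a \<times> 'a set \<times> 'a set" where
  "decode = inv_into nodes code"

definition lt :: "'a \<Rightarrow> 'a \<Rightarrow> bool" where
  "lt u v \<longleftrightarrow> node_lt (decode u) (decode v)"

definition ht :: "'a \<Rightarrow> 'a" where
  "ht u = fst (decode u)"

definition tree :: "'a set" where
  "tree = code ` nodes"

definition sub :: "'a set \<Rightarrow> 'a set" where
  "sub B = code ` subnodes B"

lemma level_nodes_small: "small {x \<in> nodes. fst x = \<alpha>}"
proof -
  have "(\<alpha>, B \<inter> oset \<alpha>, X) \<in> (\<Union>E\<in>(\<lambda>B. B \<inter> oset \<alpha>) ` F. (\<lambda>X. (\<alpha>, E, X)) ` lev \<alpha> E)"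
    if "B \<in> F" "X \<in> lev \<alpha> B" for B X
    using that lev_trace[of \<alpha> \<alpha> B] by auto
  then have "{x \<in> nodes. fst x = \<alpha>} \<subseteq> (\<Union>E\<in>(\<lambda>B. B \<inter> oset \<alpha>) ` F. (\<lambda>X. (\<alpha>, E, X)) ` lev \<alpha> E)"
    unfolding nodes_def subnodes_def by auto
  moreover have "small (\<Union>E\<in>(\<lambda>B. B \<inter> oset \<alpha>) ` F. (\<lambda>X. (\<alpha>, E, X)) ` lev \<alpha> E)"
    by (intro small_UN F_small small_image lev_small)
  ultimately show ?thesis by (rule small_subset[rotated])
qed

lemma inj_code: "inj_on code nodes"
proof -
  have "\<exists>e :: _ \<Rightarrow> 'a. inj_on e (\<Union>\<alpha>::'a. {x \<in> nodes. fst x = \<alpha>})"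
    by (rule ex_inj_into_kappa[OF level_nodes_small])
  moreover have "(\<Union>\<alpha>::'a. {x \<in> nodes. fst x = \<alpha>}) = nodes" by blast
  ultimately have "\<exists>e :: _ \<Rightarrow> 'a. inj_on e nodes" by simp
  then show ?thesis unfolding code_def by (rule someI_ex)
qed

lemma decode_code [simp]: "x \<in> nodes \<Longrightarrow> decode (code x) = x"
  unfolding decode_def by (rule inv_into_f_f[OF inj_code])

lemma subnodes_nodes: "B \<in> F \<Longrightarrow> subnodes B \<subseteq> nodes"
  unfolding nodes_def by blast

lemma subnodes_restrict:
  assumes "(\<alpha>, E, X) \<in> subnodes B" "\<beta> \<le> \<alpha>"
  shows "(\<beta>, E \<inter> oset \<beta>, X \<inter> oset \<beta>) \<in> subnodes B"
proof -
  have "E = B \<inter> oset \<alpha>" "X \<in> lev \<alpha> B" using assms(1) unfolding subnodes_def by blast+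
  moreover have "oset \<alpha> \<inter> oset \<beta> = oset \<beta>" using assms(2) by auto
  ultimately show ?thesis
    using lev_restrict[OF _ assms(2)] unfolding subnodes_def by (auto simp: Int_assoc)
qed

text \<open>Formulated for any set of nodes closed under restriction, so as to cover the common tree
  and each of its subtrees.\<close>

lemma leveled_code:
  assumes N: "N \<subseteq> nodes"
    and restrict: "\<And>\<alpha> E X \<beta>. (\<alpha>, E, X) \<in> N \<Longrightarrow> \<beta> \<le> \<alpha> \<Longrightarrow> (\<beta>, E \<inter> oset \<beta>, X \<inter> oset \<beta>) \<in> N"
  shows "leveled (code ` N) lt ht"
proof -
  have dec: "decode u \<in> N" "code (decode u) = u" if "u \<in> code ` N" for u
    using that N by auto
  have pred: "\<exists>v\<in>code ` N. lt v u \<and> ht v = \<beta>" if u: "u \<in> code ` N" and \<beta>: "\<beta> < ht u" for u \<beta>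
  proof -
    obtain \<alpha> E X where d: "decode u = (\<alpha>, E, X)" by (cases "decode u") auto
    have "\<beta> < \<alpha>" using \<beta> d unfolding ht_def by simp
    let ?y = "(\<beta>, E \<inter> oset \<beta>, X \<inter> oset \<beta>)"
    have y: "?y \<in> N" using restrict[of \<alpha> E X \<beta>] dec(1)[OF u] d \<open>\<beta> < \<alpha>\<close> by simp
    then have "decode (code ?y) = ?y" using N by auto
    then have "lt (code ?y) u \<and> ht (code ?y) = \<beta>"
      using \<open>\<beta> < \<alpha>\<close> unfolding lt_def ht_def node_lt_def d by simp
    then show ?thesis using y by blast
  qed
  have trans: "lt u w" if "lt u v" "lt v w" for u v w
  proof -
    obtain \<alpha> E X \<alpha>' E' X' \<alpha>'' E'' X'' where
      d: "decode u = (\<alpha>, E, X)" "decode v = (\<alpha>', E', X')" "decode w = (\<alpha>'', E'', X'')"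
      by (metis prod.exhaust)
    have *: "\<alpha> < \<alpha>'" "E = E' \<inter> oset \<alpha>" "X = X' \<inter> oset \<alpha>" "\<alpha>' < \<alpha>''" "E' = E'' \<inter> oset \<alpha>'" "X' = X'' \<inter> oset \<alpha>'"
      using that unfolding lt_def node_lt_def d by simp_all
    then have "oset \<alpha>' \<inter> oset \<alpha> = oset \<alpha>" by auto
    then have "E = E'' \<inter> oset \<alpha>" "X = X'' \<inter> oset \<alpha>" using * by (simp_all add: Int_assoc)
    then show ?thesis using less_trans[OF *(1,4)] unfolding lt_def node_lt_def d by simp
  qed
  have less: "ht u < ht v" if "lt u v" for u v
    using that unfolding lt_def ht_def node_lt_def by (auto simp: case_prod_beta)
  have unique: "v = w" if "u \<in> code ` N" "v \<in> code ` N" "w \<in> code ` N" "lt v u" "lt w u" "ht v = ht w"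
    for u v w
  proof -
    have "decode v = decode w"
      using that(4-6) unfolding lt_def ht_def node_lt_def by (auto simp: case_prod_beta prod_eq_iff)
    then have "code (decode v) = code (decode w)" by (rule arg_cong)
    then show ?thesis unfolding dec(2)[OF that(2)] dec(2)[OF that(3)] .
  qed
  show ?thesis
    unfolding leveled_def
  proof (intro conjI ballI allI impI, goal_cases)
    case 1 then show ?case by (intro less)
  next
    case 2 then show ?case using trans by blast
  next
    case 3 then show ?case by (intro pred)
  next
    case 4 then show ?case using unique by blast
  qed
qed

lemma leveled_tree: "leveled tree lt ht"
  unfolding tree_def
proof (rule leveled_code)
  show "(\<beta>, E \<inter> oset \<beta>, X \<inter> oset \<beta>) \<in> nodes" if "(\<alpha>, E, X) \<in> nodes" "\<beta> \<le> \<alpha>" for \<alpha> E X \<beta>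
  proof -
    obtain B where "B \<in> F" "(\<alpha>, E, X) \<in> subnodes B" using \<open>(\<alpha>, E, X) \<in> nodes\<close> unfolding nodes_def by blast
    then show ?thesis using subnodes_restrict[OF _ that(2)] unfolding nodes_def by blast
  qed
qed simp

lemma leveled_sub: "B \<in> F \<Longrightarrow> leveled (sub B) lt ht"
  unfolding sub_def by (rule leveled_code[OF subnodes_nodes subnodes_restrict])

lemma subtree_sub:
  assumes B: "B \<in> F"
  shows "subtree tree lt (sub B)"
  unfolding subtree_def
proof (intro conjI ballI impI)
  show "sub B \<subseteq> tree" unfolding sub_def tree_def using subnodes_nodes[OF B] by blast
  fix x y assume x: "x \<in> sub B" and y: "y \<in> tree" and less: "lt y x"
  obtain \<alpha> E X \<beta> E' X' where d: "decode x = (\<alpha>, E, X)" "decode y = (\<beta>, E', X')"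
    by (metis prod.exhaust)
  have "(\<alpha>, E, X) \<in> subnodes B" using x subnodes_nodes[OF B] d(1) unfolding sub_def by auto
  moreover have "\<beta> < \<alpha>" "E' = E \<inter> oset \<beta>" "X' = X \<inter> oset \<beta>"
    using less unfolding lt_def node_lt_def d by simp_all
  ultimately have "decode y \<in> subnodes B"
    using subnodes_restrict[of \<alpha> E X B \<beta>] unfolding d by simp
  moreover have "y = code (decode y)" using y unfolding tree_def by auto
  ultimately show "y \<in> sub B" unfolding sub_def by blast
qed

lemma decode_subnode: "B \<in> F \<Longrightarrow> X \<in> lev \<alpha> B \<Longrightarrow> decode (code (\<alpha>, B \<inter> oset \<alpha>, X)) = (\<alpha>, B \<inter> oset \<alpha>, X)"
  using subnodes_nodes unfolding subnodes_def by (intro decode_code) blast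

lemma sub_code: "X \<in> lev \<alpha> B \<Longrightarrow> code (\<alpha>, B \<inter> oset \<alpha>, X) \<in> sub B"
  unfolding sub_def subnodes_def by blast

lemma sub_level_nonempty: "B \<in> F \<Longrightarrow> \<exists>x\<in>sub B. ht x = \<alpha>"
proof -
  assume B: "B \<in> F"
  obtain X where X: "X \<in> lev \<alpha> B" using lev_nonempty by blast
  then show ?thesis using sub_code[OF X] decode_subnode[OF B X] unfolding ht_def by (intro bexI) simp_all
qed

lemma tree_level_small: "small {x \<in> tree. ht x = \<alpha>}"
proof (rule small_subset[OF small_image[OF level_nodes_small]])
  show "{x \<in> tree. ht x = \<alpha>} \<subseteq> code ` {x \<in> nodes. fst x = \<alpha>}"
    unfolding tree_def ht_def by auto
qed

lemma sub_subset: "B \<in> F \<Longrightarrow> sub B \<subseteq> tree"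
  using subtree_sub unfolding subtree_def by blast

lemma sub_level_small: "B \<in> F \<Longrightarrow> small {x \<in> sub B. ht x = \<alpha>}"
  by (rule small_subset[OF tree_level_small[of \<alpha>]]) (use sub_subset in blast)

lemma lev_oneup: "lev (oneup \<alpha>) E = lev \<alpha> E \<union> insert \<alpha> ` lev \<alpha> E"
  by (rule lev_successor[OF osup_oneup less_oneup])

lemma splitting_sub:
  assumes B: "B \<in> F"
  shows "splitting (sub B) lt ht"
  unfolding splitting_def
proof
  fix x assume "x \<in> sub B"
  then obtain \<alpha> X where X: "X \<in> lev \<alpha> B" and x: "x = code (\<alpha>, B \<inter> oset \<alpha>, X)"
    unfolding sub_def subnodes_def by blast
  let ?c = "\<lambda>Y. code (oneup \<alpha>, B \<inter> oset (oneup \<alpha>), Y)"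
  \<comment> \<open>The two successors leave out or include the new point \<alpha>; both have trace
    \<open>X\<close> on \<alpha>.\<close>
  have Y: "X \<in> lev (oneup \<alpha>) B" "insert \<alpha> X \<in> lev (oneup \<alpha>) B" unfolding lev_oneup using X by blast+
  have "\<alpha> \<notin> X" and X\<alpha>: "X \<inter> oset \<alpha> = X" using lev_subset[OF X] by auto
  have B\<alpha>: "B \<inter> oset (oneup \<alpha>) \<inter> oset \<alpha> = B \<inter> oset \<alpha>" unfolding oset_oneup by blast
  have dx: "decode x = (\<alpha>, B \<inter> oset \<alpha>, X)" unfolding x by (rule decode_subnode[OF B X])
  have lt_c: "lt x (?c Y) \<and> ht (?c Y) = oneup (ht x)"
    if "Y \<in> lev (oneup \<alpha>) B" "Y \<inter> oset \<alpha> = X" for Y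
    using B\<alpha> that(2) less_oneup[of \<alpha>]
    unfolding lt_def ht_def node_lt_def dx decode_subnode[OF B that(1)] by simp
  have "insert \<alpha> X \<inter> oset \<alpha> = X" using X\<alpha> by auto
  then have "lt x (?c X) \<and> ht (?c X) = oneup (ht x)"
    "lt x (?c (insert \<alpha> X)) \<and> ht (?c (insert \<alpha> X)) = oneup (ht x)"
    using lt_c[OF Y(1) X\<alpha>] lt_c[OF Y(2)] by blast+
  moreover have "?c X \<noteq> ?c (insert \<alpha> X)"
  proof
    assume "?c X = ?c (insert \<alpha> X)"
    then have "decode (?c X) = decode (?c (insert \<alpha> X))" by (rule arg_cong)
    then have "X = insert \<alpha> X" unfolding decode_subnode[OF B Y(1)] decode_subnode[OF B Y(2)] by simp
    then show False using \<open>\<alpha> \<notin> X\<close> by blast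
  qed
  moreover have "?c X \<in> sub B" "?c (insert \<alpha> X) \<in> sub B" using sub_code Y by blast+
  ultimately show "\<exists>y\<in>sub B. \<exists>z\<in>sub B. y \<noteq> z \<and> lt x y \<and> lt x z \<and>
     ht y = oneup (ht x) \<and> ht z = oneup (ht x)" by blast
qed

definition prod_coords :: "'a list \<Rightarrow> 'a set list" where
  "prod_coords us = map (\<lambda>u. snd (snd (decode u))) us"

lemma prod_sub_iff:
  assumes "set Bs \<subseteq> F"
  shows "us \<in> prod_nodes (t :: 'a itself) (map sub Bs) lt \<longleftrightarrow> length us = length Bs \<and>
    (\<forall>j < length Bs. us ! j \<in> sub (Bs ! j)) \<and> (\<exists>\<alpha>. \<forall>j < length Bs. ht (us ! j) = \<alpha>)"
proof -
  have lv: "leveled S lt ht" if "S \<in> set (map sub Bs)" for S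
    using that assms leveled_sub by auto
  have "us \<in> prod_nodes t (map sub Bs) lt \<longleftrightarrow> length us = length (map sub Bs) \<and>
    (\<forall>j < length (map sub Bs). us ! j \<in> map sub Bs ! j) \<and>
    (\<exists>\<alpha>. \<forall>j < length (map sub Bs). ht (us ! j) = \<alpha>)"
    by (rule prod_nodes_iff) (rule lv)
  then show ?thesis by simp
qed

text \<open>Translates nodes of the product of renamed trees into \<open>prodlev\<close>: the height
  and the tuple of sets together determine the node, because the traces come from
  \<open>Bs\<close>.\<close>

lemma prod_nodes_sub:
  assumes Bs: "set Bs \<subseteq> F" "Bs \<noteq> []" and us: "us \<in> prod_nodes (t :: 'a itself) (map sub Bs) lt"
  shows "prod_coords us \<in> prodlev Bs (ht (us ! 0))"
    and "us = map (\<lambda>(B, X). code (ht (us ! 0), B \<inter> oset (ht (us ! 0)), X)) (zip Bs (prod_coords us))"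
proof -
  let ?\<alpha> = "ht (us ! 0)"
  obtain \<alpha> where *: "length us = length Bs" "\<And>j. j < length Bs \<Longrightarrow> us ! j \<in> sub (Bs ! j)"
    "\<And>j. j < length Bs \<Longrightarrow> ht (us ! j) = \<alpha>"
    using us unfolding prod_sub_iff[OF Bs(1)] by blast
  then have \<alpha>: "?\<alpha> = \<alpha>" using Bs(2) by simp
  have "us ! j = code (\<alpha>, Bs ! j \<inter> oset \<alpha>, snd (snd (decode (us ! j)))) \<and>
      snd (snd (decode (us ! j))) \<in> lev \<alpha> (Bs ! j)" if j: "j < length Bs" for j
  proof -
    have BF: "Bs ! j \<in> F" using j Bs(1) by auto
    obtain \<beta> X where X: "X \<in> lev \<beta> (Bs ! j)" and u: "us ! j = code (\<beta>, Bs ! j \<inter> oset \<beta>, X)"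
      using *(2)[OF j] unfolding sub_def subnodes_def by blast
    have d: "decode (us ! j) = (\<beta>, Bs ! j \<inter> oset \<beta>, X)" unfolding u by (rule decode_subnode[OF BF X])
    then have "\<beta> = \<alpha>" using *(3)[OF j] unfolding ht_def by simp
    then show ?thesis using d X u by simp
  qed
  then show "prod_coords us \<in> prodlev Bs ?\<alpha>"
    "us = map (\<lambda>(B, X). code (?\<alpha>, B \<inter> oset ?\<alpha>, X)) (zip Bs (prod_coords us))"
    unfolding \<alpha> prod_coords_def prodlev_def using *(1) by (auto intro: nth_equalityI)
qed

text \<open>Once the heights in \<open>A\<close> are bounded, \<open>A\<close> lies in fewer than
  kappa levels of the product, each of them small.\<close>

lemma prod_antichain_small:
  assumes Bs: "set Bs \<subseteq> F" "Bs \<noteq> []" "distinct Bs"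
    and A: "antichain (prod_nodes (t :: 'a itself) (map sub Bs) lt) (prod_lt lt) A"
  shows "small A"
proof -
  let ?P = "prod_nodes t (map sub Bs) lt"
  define mk where "mk \<alpha> zs = map (\<lambda>(B, X). code (\<alpha>, B \<inter> oset \<alpha>, X)) (zip Bs zs)" for \<alpha> zs
  note P = prod_nodes_sub[OF Bs(1,2), of _ t, folded mk_def]
  have AP: "A \<subseteq> ?P" using A unfolding antichain_def by blast
  define R where "R = (\<lambda>us. (ht (us ! 0), prod_coords us)) ` A"
  have lt_mk: "prod_lt lt (mk \<gamma> ws) (mk \<gamma>' ws')"
    if ws: "ws \<in> prodlev Bs \<gamma>" "ws' \<in> prodlev Bs \<gamma>'" "\<gamma> < \<gamma>'" "map (\<lambda>Z. Z \<inter> oset \<gamma>) ws' = ws"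
    for \<gamma> \<gamma>' ws ws'
  proof -
    have len: "length ws = length Bs" "length ws' = length Bs" using ws unfolding prodlev_def by blast+
    have "lt (mk \<gamma> ws ! j) (mk \<gamma>' ws' ! j)" if j: "j < length Bs" for j
    proof -
      have BF: "Bs ! j \<in> F" using j Bs(1) by auto
      have w: "ws ! j \<in> lev \<gamma> (Bs ! j)" "ws' ! j \<in> lev \<gamma>' (Bs ! j)"
        using ws(1,2) j unfolding prodlev_def by blast+
      have "ws ! j = ws' ! j \<inter> oset \<gamma>" using ws(4) j len by auto
      moreover have "oset \<gamma>' \<inter> oset \<gamma> = oset \<gamma>" using ws(3) by auto
      ultimately have "node_lt (\<gamma>, Bs ! j \<inter> oset \<gamma>, ws ! j) (\<gamma>', Bs ! j \<inter> oset \<gamma>', ws' ! j)"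
        using ws(3) unfolding node_lt_def by (simp add: Int_assoc)
      moreover have "mk \<gamma> ws ! j = code (\<gamma>, Bs ! j \<inter> oset \<gamma>, ws ! j)"
        "mk \<gamma>' ws' ! j = code (\<gamma>', Bs ! j \<inter> oset \<gamma>', ws' ! j)"
        using j len unfolding mk_def by simp_all
      ultimately show ?thesis
        unfolding lt_def by (simp only: decode_subnode[OF BF w(1)] decode_subnode[OF BF w(2)])
    qed
    then show ?thesis unfolding prod_lt_def using len by (simp add: mk_def)
  qed
  obtain \<alpha> where \<alpha>: "\<And>\<gamma> ws. (\<gamma>, ws) \<in> R \<Longrightarrow> \<gamma> \<le> \<alpha>"
  proof (rule prodlev_antichain_bounded[OF Bs(3), of R])
    show "ws \<in> prodlev Bs \<gamma>" if "(\<gamma>, ws) \<in> R" for \<gamma> ws using that P(1) AP unfolding R_def by auto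
    show "map (\<lambda>Z. Z \<inter> oset \<gamma>) ws' \<noteq> ws" if w: "(\<gamma>, ws) \<in> R" "(\<gamma>', ws') \<in> R" "\<gamma> < \<gamma>'" for \<gamma> ws \<gamma>' ws'
    proof
      assume r: "map (\<lambda>Z. Z \<inter> oset \<gamma>) ws' = ws"
      obtain us vs where uv: "us \<in> A" "vs \<in> A" "\<gamma> = ht (us ! 0)" "ws = prod_coords us"
        "\<gamma>' = ht (vs ! 0)" "ws' = prod_coords vs" using w unfolding R_def by blast
      have us: "us = mk \<gamma> ws" "ws \<in> prodlev Bs \<gamma>" and vs: "vs = mk \<gamma>' ws'" "ws' \<in> prodlev Bs \<gamma>'"
        unfolding uv(3-6) using P subsetD[OF AP] uv(1,2) by blast+
      have "prod_lt lt us vs" unfolding us(1) vs(1) by (rule lt_mk[OF us(2) vs(2) w(3) r])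
      moreover have "us \<noteq> vs" using uv w(3) by auto
      ultimately show False using A uv(1,2) unfolding antichain_def by blast
    qed
  qed blast
  have "A \<subseteq> (\<Union>\<gamma>\<in>{..\<alpha>}. mk \<gamma> ` prodlev Bs \<gamma>)"
  proof
    fix us assume us: "us \<in> A"
    have "ht (us ! 0) \<le> \<alpha>" using \<alpha> us unfolding R_def by blast
    moreover have "us = mk (ht (us ! 0)) (prod_coords us)" "prod_coords us \<in> prodlev Bs (ht (us ! 0))"
      using P subsetD[OF AP us] by blast+
    ultimately show "us \<in> (\<Union>\<gamma>\<in>{..\<alpha>}. mk \<gamma> ` prodlev Bs \<gamma>)" by blast
  qed
  then show ?thesis
    by (rule small_subset[rotated]) (intro small_UN small_atMost small_image prodlev_small)
qed

text \<open>A single tree is its own product with one factor.\<close>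

lemma sub_antichain_small:
  assumes B: "B \<in> F" and A: "antichain (sub B) lt A"
  shows "small A"
proof -
  have "set [B] \<subseteq> F" using B by simp
  note P = prod_sub_iff[OF this, of _ "TYPE('a)"]
  have "antichain (prod_nodes TYPE('a) (map sub [B]) lt) (prod_lt lt) ((\<lambda>x. [x]) ` A)"
    using A unfolding antichain_def prod_lt_def by (auto simp: P[simplified])
  then have "small ((\<lambda>x. [x]) ` A)" by (rule prod_antichain_small[rotated 3]) (use B in auto)
  then have "small (hd ` (\<lambda>x. [x]) ` A)" by (rule small_image)
  then show ?thesis by (simp add: image_image)
qed

lemma souslin_sub: "B \<in> F \<Longrightarrow> souslin (t :: 'a itself) (sub B) lt"
  by (rule souslinI[OF leveled_sub splitting_sub sub_level_nonempty sub_level_small sub_antichain_small])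

lemma souslin_prod:
  assumes Bs: "set Bs \<subseteq> F" "Bs \<noteq> []" "distinct Bs"
  shows "souslin (t :: 'a itself) (prod_nodes t (map sub Bs) lt) (prod_lt lt)"
proof (rule souslinI)
  let ?P = "prod_nodes t (map sub Bs) lt"
  have lv: "leveled S lt ht" and split: "splitting S lt ht" if "S \<in> set (map sub Bs)" for S
    using that Bs(1) leveled_sub splitting_sub by auto
  show "leveled ?P (prod_lt lt) (\<lambda>us. ht (us ! 0))"
    using Bs(2) by (intro leveled_prod lv) auto
  show "splitting ?P (prod_lt lt) (\<lambda>us. ht (us ! 0))"
    using Bs(2) by (intro splitting_prod lv split) auto
  show "small A" if "antichain ?P (prod_lt lt) A" for A
    using prod_antichain_small[OF Bs that] .
  fix \<alpha>
  show "\<exists>us\<in>?P. ht (us ! 0) = \<alpha>"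
  proof -
    have "\<forall>j<length Bs. \<exists>u. u \<in> sub (Bs ! j) \<and> ht u = \<alpha>"
      using sub_level_nonempty[OF subsetD[OF Bs(1) nth_mem]] by blast
    then obtain us where us: "length us = length Bs" "\<And>j. j < length Bs \<Longrightarrow> us ! j \<in> sub (Bs ! j) \<and> ht (us ! j) = \<alpha>"
      unfolding Skolem_list_nth by blast
    then have "us \<in> ?P" unfolding prod_sub_iff[OF Bs(1)] by blast
    moreover have "ht (us ! 0) = \<alpha>" using us(2)[of 0] Bs(2) by simp
    ultimately show ?thesis by blast
  qed
  show "small {us \<in> ?P. ht (us ! 0) = \<alpha>}"
  proof (rule small_subset[OF small_image[OF prodlev_small]])
    show "{us \<in> ?P. ht (us ! 0) = \<alpha>}
        \<subseteq> (\<lambda>zs. map (\<lambda>(B, X). code (\<alpha>, B \<inter> oset \<alpha>, X)) (zip Bs zs)) ` prodlev Bs \<alpha>"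
    proof
      fix us assume "us \<in> {us \<in> ?P. ht (us ! 0) = \<alpha>}"
      then have "us \<in> ?P" "ht (us ! 0) = \<alpha>" by blast+
      then show "us \<in> (\<lambda>zs. map (\<lambda>(B, X). code (\<alpha>, B \<inter> oset \<alpha>, X)) (zip Bs zs)) ` prodlev Bs \<alpha>"
        using prod_nodes_sub[OF Bs(1,2), of us t] by blast
    qed
  qed
qed

lemma aronszajn_tree:
  assumes "F \<noteq> {}"
  shows "aronszajn (t :: 'a itself) tree lt"
  unfolding aronszajn_def
proof (intro conjI notI)
  obtain B0 where B0: "B0 \<in> F" using assms by blast
  have "\<exists>x\<in>tree. ht x = \<alpha>" for \<alpha> using sub_level_nonempty[OF B0, of \<alpha>] sub_subset[OF B0] by blast
  then show "kappa_tree t tree lt" by (rule leveled_kappa_tree[OF leveled_tree _ tree_level_small])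
  assume "\<exists>b. cofinal_branch t tree lt b"
  then obtain b where "cofinal_branch t tree lt b" by blast
  then have b: "b \<subseteq> tree" "\<And>x y. x \<in> b \<Longrightarrow> y \<in> b \<Longrightarrow> lt x y \<or> x = y \<or> lt y x"
    "\<And>x y. x \<in> b \<Longrightarrow> y \<in> tree \<Longrightarrow> lt y x \<Longrightarrow> y \<in> b" "\<And>\<alpha>::'a. b \<inter> level tree lt \<alpha> \<noteq> {}"
    unfolding cofinal_branch_def by blast+
  \<comment> \<open>The traces along a branch cohere, so their union has each of them as its trace
    at the corresponding height.\<close>
  define B where "B = (\<Union>u\<in>b. fst (snd (decode u)))"
  have node: "\<exists>B'\<in>F. \<exists>X\<in>lev (ht u) B'. decode u = (ht u, B' \<inter> oset (ht u), X) \<and> u = code (decode u)"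
    if "u \<in> b" for u
  proof -
    obtain x where x: "x \<in> nodes" "u = code x" using b(1) \<open>u \<in> b\<close> unfolding tree_def by blast
    then obtain B' \<alpha> X where "B' \<in> F" "X \<in> lev \<alpha> B'" "x = (\<alpha>, B' \<inter> oset \<alpha>, X)"
      unfolding nodes_def subnodes_def by blast
    then show ?thesis using x unfolding ht_def by auto
  qed
  have trace: "fst (snd (decode u)) = B \<inter> oset (ht u)" if u: "u \<in> b" for u
  proof
    have "fst (snd (decode u)) \<subseteq> oset (ht u)" using node[OF u] by auto
    then show "fst (snd (decode u)) \<subseteq> B \<inter> oset (ht u)" unfolding B_def using u by blast
    show "B \<inter> oset (ht u) \<subseteq> fst (snd (decode u))"
    proof
      fix \<xi> assume "\<xi> \<in> B \<inter> oset (ht u)"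
      then obtain v where v: "v \<in> b" "\<xi> \<in> fst (snd (decode v))" "\<xi> < ht u" unfolding B_def by blast
      show "\<xi> \<in> fst (snd (decode u))"
        using b(2)[OF u v(1)] v(2,3) unfolding lt_def node_lt_def ht_def by (auto simp: case_prod_beta)
    qed
  qed
  have lev: "\<exists>u\<in>b. ht u = \<alpha>" for \<alpha>
    using b(4)[of \<alpha>] leveled_has_height[OF leveled_tree] unfolding level_def by blast
  have "B \<inter> oset \<alpha> \<in> (\<lambda>B. B \<inter> oset \<alpha>) ` F" for \<alpha>
  proof -
    obtain u where u: "u \<in> b" "ht u = \<alpha>" using lev by blast
    obtain B' X where "B' \<in> F" "decode u = (\<alpha>, B' \<inter> oset \<alpha>, X)" using node[OF u(1)] u(2) by blast
    moreover from this(2) have "B \<inter> oset \<alpha> = B' \<inter> oset \<alpha>" using trace[OF u(1)] u(2) by simp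
    ultimately show ?thesis by blast
  qed
  \<comment> \<open>Closure under limits of traces is decisive here: different heights may have used
    different members of \<open>F\<close>. Now the branch runs inside the Souslin tree
    \<open>sub B\<close>.\<close>
  then have BF: "B \<in> F" by (rule F_closed)
  have sub: "b \<subseteq> sub B"
  proof
    fix u assume u: "u \<in> b"
    obtain B' X where X: "X \<in> lev (ht u) B'" "decode u = (ht u, B' \<inter> oset (ht u), X)" "u = code (decode u)"
      using node[OF u] by blast
    have eq: "B \<inter> oset (ht u) = B' \<inter> oset (ht u)" using trace[OF u] X(2) by simp
    then have "X \<in> lev (ht u) B" using X(1) lev_cong[OF eq] by simp
    then have "code (ht u, B \<inter> oset (ht u), X) \<in> sub B" by (rule sub_code)
    then show "u \<in> sub B" unfolding eq X(2)[symmetric] X(3)[symmetric] .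
  qed
  have "b \<inter> level (sub B) lt \<alpha> \<noteq> {}" for \<alpha> :: 'a
    using lev[of \<alpha>] sub leveled_has_height[OF leveled_sub[OF BF]] unfolding level_def by blast
  moreover have "y \<in> b" if "x \<in> b" "y \<in> sub B" "lt y x" for x y
    using b(3) that sub_subset[OF BF] by blast
  ultimately have "cofinal_branch t (sub B) lt b" unfolding cofinal_branch_def using sub b(2) by blast
  then show False using souslin_sub[OF BF] unfolding souslin_def aronszajn_def by blast
qed

text \<open>All levels are nonempty, so every trace of \<open>B\<close> is recorded in some node and
  \<open>B\<close> can be recovered. Injectivity is what turns the size of the family into the
  number of subtrees.\<close>

lemma inj_sub: "inj_on sub F"
proof (rule inj_onI)
  fix B B' assume B: "B \<in> F" "B' \<in> F" "sub B = sub B'"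
  have "B \<inter> oset \<alpha> = B' \<inter> oset \<alpha>" for \<alpha>
  proof -
    obtain X where X: "X \<in> lev \<alpha> B" using lev_nonempty by blast
    have "code (\<alpha>, B \<inter> oset \<alpha>, X) \<in> sub B'" using sub_code[OF X] B(3) by simp
    then obtain \<beta> Y where Y: "Y \<in> lev \<beta> B'" "code (\<alpha>, B \<inter> oset \<alpha>, X) = code (\<beta>, B' \<inter> oset \<beta>, Y)"
      unfolding sub_def subnodes_def by blast
    then show ?thesis using decode_subnode[OF B(1) X] decode_subnode[OF B(2) Y(1)] by auto
  qed
  then have "\<xi> \<in> B \<longleftrightarrow> \<xi> \<in> B'" for \<xi> using less_oneup[of \<xi>] by blast
  then show "B = B'" by blast
qed

end

theorem theoremA:
  fixes t :: "'a::wellorder itself"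
  assumes kappa_card: "card_order (kappa_rel :: 'a rel)"
    and kappa_regular: "regularCard (kappa_rel :: 'a rel)"
    and kappa_uncountable: "ordLess2 natLeq (kappa_rel :: 'a rel)"
    and proxy: "proxy_P t"
    and kurepa_exists: "\<exists>(K :: 'n set) lt. kurepa t K lt"
  shows "\<exists>(T :: 'a set) lt. aronszajn t T lt \<and>
           (\<exists>\<S>. ordIso2 (card_of \<S>) (cardSuc (kappa_rel :: 'a rel)) \<and>
              (\<forall>S\<in>\<S>. subtree T lt S \<and> souslin t S lt) \<and>
              (\<forall>Ts. Ts \<noteq> [] \<and> distinct Ts \<and> set Ts \<subseteq> \<S> \<longrightarrow>
                   souslin t (prod_nodes t Ts lt) (prod_lt lt)))"
proof -
  interpret regular_cardinal "kappa_rel :: 'a rel"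
    by unfold_locales (use kappa_card kappa_regular kappa_uncountable in simp_all)
  obtain K :: "'n set" and K_lt where "kurepa t K K_lt" using kurepa_exists by blast
  then obtain F :: "'a set set" where F: "ordLess2 (kappa_rel :: 'a rel) (card_of F)"
    "\<And>\<alpha>. small ((\<lambda>B. B \<inter> oset \<alpha>) ` F)"
    "\<And>B. (\<And>\<alpha>. B \<inter> oset \<alpha> \<in> (\<lambda>B. B \<inter> oset \<alpha>) ` F) \<Longrightarrow> B \<in> F"
    by (rule kurepa_family) blast
  have "diamond t" using proxy unfolding proxy_P_def by blast
  then obtain G :: "'a \<Rightarrow> 'a set list \<times> ('a \<times> 'a set) list \<times> ('a \<times> 'a set list) set" where
    G: "\<And>Bs xs D \<xi> g. length xs = length Bs \<Longrightarrow> (\<And>x. x \<in> set xs \<Longrightarrow> snd x \<subseteq> oset (fst x)) \<Longrightarrow>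
       (\<And>\<delta> zs Z. (\<delta>, zs) \<in> D \<Longrightarrow> Z \<in> set zs \<Longrightarrow> Z \<subseteq> oset \<delta>) \<Longrightarrow>
       (\<And>\<delta>. small {zs. (\<delta>, zs) \<in> D}) \<Longrightarrow>
       \<exists>\<beta>. \<xi> < \<beta> \<and> (\<forall>\<eta><\<beta>. g \<eta> < \<beta>) \<and>
           G \<beta> = (map (\<lambda>B. B \<inter> oset \<beta>) Bs, xs, {(\<delta>, zs) \<in> D. \<delta> < \<beta>})"
    by (rule ex_guess) blast
  obtain C :: "'a \<Rightarrow> 'a set" where
    C: "\<forall>\<alpha>. closed_subset_of (C \<alpha>) \<alpha> \<and> osup (C \<alpha>) = osup (oset \<alpha>)"
    "\<forall>\<alpha>. \<forall>\<alpha>' \<in> acc (C \<alpha>). C \<alpha>' = C \<alpha> \<inter> oset \<alpha>'"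
    "\<forall>B :: 'a \<Rightarrow> 'a set. (\<forall>i. unbounded (B i)) \<longrightarrow>
          stationary {\<alpha>. \<forall>i < \<alpha>. \<forall>n::nat. osup {\<beta> \<in> C \<alpha>. suc_n n (C \<alpha> - oset \<beta>) \<subseteq> B i} = \<alpha>}"
    using proxy unfolding proxy_P_def by (elim conjE exE) blast
  interpret kurepa_construction "kappa_rel :: 'a rel" C G F
  proof unfold_locales
    show "closed_subset_of (C \<alpha>) \<alpha>" "osup (C \<alpha>) = osup (oset \<alpha>)" for \<alpha> using C(1) by blast+
    show "C \<alpha>' = C \<alpha> \<inter> oset \<alpha>'" if "\<alpha>' \<in> acc (C \<alpha>)" for \<alpha> \<alpha>' using C(2) that by blast
    show "stationary {\<alpha>. \<forall>i < \<alpha>. \<forall>n::nat. osup {\<beta> \<in> C \<alpha>. suc_n n (C \<alpha> - oset \<beta>) \<subseteq> B i} = \<alpha>}"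
      if "\<And>i. unbounded (B i)" for B :: "'a \<Rightarrow> 'a set" using C(3)[rule_format, OF that] .
  qed (fact G F)+
  \<comment> \<open>The tree is built from all of \<open>F\<close>, which is closed under limits;
    only the family of selected subtrees is cut down to size kappa^+.\<close>
  obtain F' where F': "F' \<subseteq> F" "ordIso2 (card_of F') (cardSuc (kappa_rel :: 'a rel))"
    using ex_subset_cardSuc[OF F(1)] by blast
  have "F \<noteq> {}"
  proof
    assume "F = {}"
    then have "small F" by (simp add: small_finite)
    then show False using F(1) ordLess_transitive ordLess_irreflexive by blast
  qed
  have "bij_betw sub F' (sub ` F')"
    using inj_on_subset[OF inj_sub F'(1)] by (rule inj_on_imp_bij_betw)
  then have "ordIso2 (card_of F') (card_of (sub ` F'))" using card_of_ordIso by blast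
  then have "ordIso2 (card_of (sub ` F')) (cardSuc (kappa_rel :: 'a rel))"
    using F'(2) ordIso_symmetric ordIso_transitive by blast
  moreover have "subtree tree lt S \<and> souslin t S lt" if "S \<in> sub ` F'" for S
    using that F'(1) subtree_sub souslin_sub by blast
  moreover have "souslin t (prod_nodes t Ts lt) (prod_lt lt)"
    if Ts: "Ts \<noteq> []" "distinct Ts" "set Ts \<subseteq> sub ` F'" for Ts
  proof -
    have "Ts \<in> map sub ` lists F'" using Ts(3) unfolding lists_image[symmetric] by auto
    then obtain Bs where Bs: "Bs \<in> lists F'" "Ts = map sub Bs" by blast
    then have "set Bs \<subseteq> F" using F'(1) by auto
    then show ?thesis unfolding Bs(2) using Ts Bs(2) by (intro souslin_prod) (auto simp: distinct_map)
  qed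
  ultimately show ?thesis using aronszajn_tree[OF \<open>F \<noteq> {}\<close>, of t] by blast
qed

end
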